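(* Let $X$ be a uniformly convex and uniformly smooth real Banach space whose modulus of smoothness is of power type $s$, $s\in(1,2]$. Then there are positive constants $\beta_L$ and $L$ (not depending on $A$, $R$, $x_0$, $x_1$ below) with the following property. Let $R>0$, let $A\subset X$ be a proximally smooth set with constant $R$, and let $x_0,x_1\in A$ be distinct points with $\frac{\|x_0-x_1\|}{R}<\beta_L$. Then the curve-construction algorithm (described in the context) applied to $A,x_0,x_1$ returns a curve $\gamma$ in $A$ with endpoints $x_0$ and $x_1$ (that is, at every step the required slice-projections exist, and, for whatever choice of them, the resulting function $f$ on the dyadic rationals of $[0,1]$ extends to a continuous map $f:[0,1]\to A$ with $f(0)=x_0$, $f(1)=x_1$; $\gamma=f([0,1])$), such that $$\mathrm{length}(\gamma)\le \|x_0-x_1\|\left(1+L\left(\frac{\|x_0-x_1\|}{R}\right)^{s(s-1)}\right).$$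
   Context: Modulus of smoothness: $\varrho_X(\tau)=\sup\left\{\frac{\|x+y\|+\|x-y\|}{2}-1:\ \|x\|=1,\ \|y\|=\tau\right\}$, $\tau\ge 0$. It is of power type $s$ if there is a constant $C_{sm}$ with $\varrho_X(\tau)\le C_{sm}\tau^s$ for all $\tau\ge0$; here $s\in(1,2]$. $X$ is uniformly smooth if $\varrho_X(\tau)/\tau\to0$ as $\tau\to0$. Uniform convexity is the usual notion. Distance and metric projection: $\mathrm{dist}(x,A)=\inf_{a\in A}\|x-a\|$, $P_A(x)=\{a\in A:\|a-x\|=\mathrm{dist}(x,A)\}$, and $P_A([x_0,x_1])=\bigcup_{x\in[x_0,x_1]}P_A(x)$. A set $A\subset X$ is proximally smooth with constant $R>0$ if it is closed and the function $x\mapsto \mathrm{dist}(x,A)$ is continuously differentiable on the open set $\{x\in X:0<\mathrm{dist}(x,A)<R\}$. For a non-zero $x\in X$ let $p\in X^*$ be the unique unit functional with $\langle p,x\rangle=\|x\|$, and let $H_x=\{y\in X:\langle p,y\rangle=0\}$. Slice-projection: for distinct points $u,v\in A$ with $\|u-v\|<2R$, a slice-projection of the midpoint $\frac{u+v}{2}$ of the segment $[u,v]$ onto $A$ is any point of the set $P_A([u,v])\cap\left(H_{u-v}+\frac{u+v}{2}\right)$. Curve-construction algorithm. Input: a proximally smooth set $A$ with constant $R$ and distinct $x_0,x_1\in A$. Let $S_i=\{j/2^i: j=0,1,\dots,2^i\}$ for $i\ge0$. (1) Put $f(0)=x_0$, $f(1)=x_1$. (2) For $i=1,2,\dots$, extend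 $f$ from $S_{i-1}$ to $S_i$ by letting $f\left(\frac{2j-1}{2^i}\right)$ be a slice-projection onto $A$ of the midpoint of the segment $\left[f\left(\frac{j-1}{2^{i-1}}\right),f\left(\frac{j}{2^{i-1}}\right)\right]$, for each $j\in\{1,\dots,2^{i-1}\}$. (3) Extend $f$ continuously to $[0,1]$. Output: the curve $\gamma=f([0,1])$, parametrized by $f$. *)

theory Defs
  imports "HOL-Analysis.Analysis"
begin

definition uniformly_convex_space :: "'a::real_normed_vector itself \<Rightarrow> bool" where
  "uniformly_convex_space (X :: 'a itself) \<longleftrightarrow>
     (\<forall>\<epsilon>>0. \<exists>\<delta>>0. \<forall>x y :: 'a.
        norm x = 1 \<and> norm y = 1 \<and> norm (x - y) \<ge> \<epsilon> \<longrightarrow> norm ((x + y) /\<^sub>R 2) \<le> 1 - \<delta>)"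

(* The set below is bounded above by tau; it is non-empty (for tau \<ge> 0) unless the space is {0},
   where the supremum is unspecified. *)
definition modulus_of_smoothness :: "'a::real_normed_vector itself \<Rightarrow> real \<Rightarrow> real" where
  "modulus_of_smoothness (X :: 'a itself) \<tau> =
     Sup {(norm (x + y) + norm (x - y)) / 2 - 1 | x y :: 'a. norm x = 1 \<and> norm y = \<tau>}"

definition uniformly_smooth_space :: "'a::real_normed_vector itself \<Rightarrow> bool" where
  "uniformly_smooth_space X \<longleftrightarrow> ((\<lambda>\<tau>. modulus_of_smoothness X \<tau> / \<tau>) \<longlongrightarrow> 0) (at_right 0)"

definition smoothness_power_type :: "'a::real_normed_vector itself \<Rightarrow> real \<Rightarrow> bool" where
  "smoothness_power_type X s \<longleftrightarrow>
     (\<exists>C. \<forall>\<tau>\<ge>0. modulus_of_smoothness X \<tau> \<le> C * \<tau> powr s)"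

definition metric_projection :: "'a::real_normed_vector set \<Rightarrow> 'a \<Rightarrow> 'a set" where
  "metric_projection A x = {a \<in> A. norm (a - x) = infdist x A}"

(* Continuous differentiability is in the Frechet sense, with the derivative continuous in the
   operator norm. *)
definition proximally_smooth :: "real \<Rightarrow> 'a::real_normed_vector set \<Rightarrow> bool" where
  "proximally_smooth R A \<longleftrightarrow> R > 0 \<and> closed A \<and>
     (\<exists>D :: 'a \<Rightarrow> 'a \<Rightarrow>\<^sub>L real.
        (\<forall>x \<in> {x. 0 < infdist x A \<and> infdist x A < R}.
           ((\<lambda>z. infdist z A) has_derivative blinfun_apply (D x)) (at x)) \<and>
        continuous_on {x. 0 < infdist x A \<and> infdist x A < R} D)"

(* The norming functional of a non-zero x; it is unique when the space is smooth. *)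
definition norming_functional :: "'a::real_normed_vector \<Rightarrow> 'a \<Rightarrow>\<^sub>L real" where
  "norming_functional x = (THE p. norm p = 1 \<and> blinfun_apply p x = norm x)"

definition norming_hyperplane :: "'a::real_normed_vector \<Rightarrow> 'a set" where
  "norming_hyperplane x = {y. blinfun_apply (norming_functional x) y = 0}"

(* The conditions on u and v are part of the notion: without them there is no slice-projection. *)
definition slice_projections :: "real \<Rightarrow> 'a::real_normed_vector set \<Rightarrow> 'a \<Rightarrow> 'a \<Rightarrow> 'a set" where
  "slice_projections R A u v =
     {w. u \<in> A \<and> v \<in> A \<and> u \<noteq> v \<and> norm (u - v) < 2 * R \<and>
         w \<in> (\<Union>x \<in> closed_segment u v. metric_projection A x) \<and>
         w \<in> (\<lambda>h. h + midpoint u v) ` norming_hyperplane (u - v)}"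

definition dyadic_points :: "nat \<Rightarrow> real set" where
  "dyadic_points i = {real j / 2 ^ i | j. j \<le> 2 ^ i}"

(* The first n refinement steps of the curve construction have been carried out, with the values of
   f on dyadic_points n as the choices made; other values of f are irrelevant. *)
definition construction_steps ::
  "real \<Rightarrow> 'a::real_normed_vector set \<Rightarrow> 'a \<Rightarrow> 'a \<Rightarrow> nat \<Rightarrow> (real \<Rightarrow> 'a) \<Rightarrow> bool" where
  "construction_steps R A x\<^sub>0 x\<^sub>1 n f \<longleftrightarrow> f 0 = x\<^sub>0 \<and> f 1 = x\<^sub>1 \<and>
     (\<forall>i \<in> {1..n}. \<forall>j \<in> {1..2 ^ (i - 1)}.
        f ((2 * real j - 1) / 2 ^ i) \<in>
          slice_projections R A (f ((real j - 1) / 2 ^ (i - 1))) (f (real j / 2 ^ (i - 1))))"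

definition curve_length :: "(real \<Rightarrow> 'a::real_normed_vector) \<Rightarrow> real \<Rightarrow> real \<Rightarrow> ennreal" where
  "curve_length g a b =
     Sup {(\<Sum>k<n. ennreal (norm (g (t (Suc k)) - g (t k)))) | (n :: nat) t.
            t 0 = a \<and> t n = b \<and> mono_on {..n} t}"

end

(*
  Let d be the distance to A. Where d is differentiable and 0 < d < R, a minimizing sequence gives
  directions on which the derivative almost attains its norm 1, so by uniform convexity the
  metric projection exists, is unique and is continuous. Moreover d can be increased from x at a
  rate arbitrarily close to 1 up to any level r < R (a completeness argument in the style of
  Ekeland), and uniform convexity forces the points so reached to lie close to the ray from the
  projection a through x. Hence, for the unit vector n in direction x - a, the open ball of radius
  R about a + R n misses A.

  Expanding the norm at R n to order s then bounds d on a chord [u, v] of A by a multiple of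
  l (l / R)^(s - 1), where l = |u - v|. A slice-projection w is therefore that close to the midpoint,
  and since it deviates from it in the kernel of the norming functional of u - v, expanding the norm
  at u - v gives |u - w|, |w - v| <= l / 2 (1 + K (l / R)^(s (s - 1))). The relative errors are
  summable along the dyadic refinement, so f is Lipschitz on the dyadic rationals with constant
  |x0 - x1| (1 + L (|x0 - x1| / R)^(s (s - 1))), which bounds the length of its extension.
*)
theory Submission
  imports Defs
begin

section \<open>The derivative of a smooth norm and its expansion to order s\<close>

subsection \<open>Norming functionals\<close>

(* The one-sided directional derivative of the norm. By smoothness it is linear in y, so it
   provides the norming functional of x without the Hahn-Banach theorem. *)
definition norm_dderiv :: "'a::real_normed_vector \<Rightarrow> 'a \<Rightarrow> real" where
  "norm_dderiv x y = (INF t\<in>{0<..}. (norm (x + t *\<^sub>R y) - norm x) / t)"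

lemma norm_quotient_ge:
  fixes x y :: "'a::real_normed_vector"
  assumes "0 < t"
  shows "- norm y \<le> (norm (x + t *\<^sub>R y) - norm x) / t"
proof -
  have "norm x \<le> norm (x + t *\<^sub>R y) + norm (t *\<^sub>R y)"
    by (metis norm_triangle_ineq4 add_diff_cancel)
  then show ?thesis using assms by (simp add: field_simps)
qed

lemma norm_quotient_le:
  fixes x y :: "'a::real_normed_vector"
  assumes "0 < t"
  shows "(norm (x + t *\<^sub>R y) - norm x) / t \<le> norm y"
proof -
  have "norm (x + t *\<^sub>R y) \<le> norm x + t * norm y"
    using norm_triangle_ineq[of x "t *\<^sub>R y"] assms by simp
  then show ?thesis using assms by (simp add: field_simps)
qed

text \<open>Convexity of the norm along the line. The infimum defining \<open>norm_dderiv\<close> is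
  thus a limit as t decreases to 0, and quotients at different t can be compared at a smaller common
  one.\<close>

lemma norm_quotient_mono:
  fixes x y :: "'a::real_normed_vector"
  assumes "0 < t" "t \<le> t'"
  shows "(norm (x + t *\<^sub>R y) - norm x) / t \<le> (norm (x + t' *\<^sub>R y) - norm x) / t'"
proof -
  define c where "c = t / t'"
  have c: "0 < c" "c \<le> 1" "t = c * t'" using assms by (auto simp: c_def)
  have "x + t *\<^sub>R y = (1 - c) *\<^sub>R x + c *\<^sub>R (x + t' *\<^sub>R y)"
    by (simp add: c(3) algebra_simps)
  then have "norm (x + t *\<^sub>R y) \<le> (1 - c) * norm x + c * norm (x + t' *\<^sub>R y)"
    using c norm_triangle_ineq[of "(1 - c) *\<^sub>R x" "c *\<^sub>R (x + t' *\<^sub>R y)"] by simp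
  then have "norm (x + t *\<^sub>R y) - norm x \<le> c * (norm (x + t' *\<^sub>R y) - norm x)"
    by (simp add: algebra_simps)
  then have "(norm (x + t *\<^sub>R y) - norm x) / t \<le> c * (norm (x + t' *\<^sub>R y) - norm x) / t"
    using assms by (simp add: divide_right_mono)
  also have "\<dots> = (norm (x + t' *\<^sub>R y) - norm x) / t'"
    using c assms by simp
  finally show ?thesis .
qed

lemma norm_dderiv_le:
  assumes "0 < t"
  shows "norm_dderiv x y \<le> (norm (x + t *\<^sub>R y) - norm x) / t"
  unfolding norm_dderiv_def using assms
  by (intro cINF_lower bdd_belowI2[where m = "- norm y"]) (auto intro: norm_quotient_ge)

lemma norm_dderiv_greatest:
  assumes "\<And>t. 0 < t \<Longrightarrow> b \<le> (norm (x + t *\<^sub>R y) - norm x) / t"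
  shows "b \<le> norm_dderiv x y"
  unfolding norm_dderiv_def using assms by (intro cINF_greatest) (auto intro: exI[of _ 1])

lemma abs_norm_dderiv_le: "\<bar>norm_dderiv x y\<bar> \<le> norm y"
proof -
  have "norm_dderiv x y \<le> norm y"
    using norm_dderiv_le[of 1 x y] norm_quotient_le[of 1 x y] by simp
  moreover have "- norm y \<le> norm_dderiv x y"
    by (rule norm_dderiv_greatest) (rule norm_quotient_ge)
  ultimately show ?thesis by simp
qed

lemma norm_dderiv_scale_le:
  assumes "0 < c"
  shows "norm_dderiv x (c *\<^sub>R y) \<le> c * norm_dderiv x y"
proof -
  have "norm_dderiv x (c *\<^sub>R y) / c \<le> norm_dderiv x y"
  proof (rule norm_dderiv_greatest)
    fix t :: real assume "0 < t"
    then have "norm_dderiv x (c *\<^sub>R y) \<le> (norm (x + (t / c) *\<^sub>R (c *\<^sub>R y)) - norm x) / (t / c)"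
      using assms by (intro norm_dderiv_le) simp
    then show "norm_dderiv x (c *\<^sub>R y) / c \<le> (norm (x + t *\<^sub>R y) - norm x) / t"
      using assms \<open>0 < t\<close> by (simp add: field_simps)
  qed
  then show ?thesis using assms by (simp add: field_simps)
qed

lemma norm_dderiv_scale:
  assumes "0 < c"
  shows "norm_dderiv x (c *\<^sub>R y) = c * norm_dderiv x y"
proof (rule antisym[OF norm_dderiv_scale_le[OF assms]])
  have "norm_dderiv x (inverse c *\<^sub>R (c *\<^sub>R y)) \<le> inverse c * norm_dderiv x (c *\<^sub>R y)"
    using assms by (intro norm_dderiv_scale_le) simp
  then show "c * norm_dderiv x y \<le> norm_dderiv x (c *\<^sub>R y)"
    using assms by (simp add: field_simps)
qed

text \<open>The point x + r(y + z) is the midpoint of x + 2r y and x + 2r z. The infima for y and z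
  may be approached at different parameters t and t', so monotonicity of the quotients first brings
  both down to the common parameter 2r.\<close>

lemma norm_dderiv_add_le: "norm_dderiv x (y + z) \<le> norm_dderiv x y + norm_dderiv x z"
proof -
  let ?q = "\<lambda>t y. (norm (x + t *\<^sub>R y) - norm x) / t"
  have *: "norm_dderiv x (y + z) \<le> ?q t y + ?q t' z" if t: "0 < t" "0 < t'" for t t'
  proof -
    define r where "r = min t t' / 2"
    have r: "0 < r" "2 * r \<le> t" "2 * r \<le> t'" using t by (auto simp: r_def)
    have "2 *\<^sub>R (x + r *\<^sub>R (y + z)) = (x + (2 * r) *\<^sub>R y) + (x + (2 * r) *\<^sub>R z)"
      by (simp add: algebra_simps scaleR_2)
    then have "norm (2 *\<^sub>R (x + r *\<^sub>R (y + z))) \<le> norm (x + (2 * r) *\<^sub>R y) + norm (x + (2 * r) *\<^sub>R z)"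
      by (metis norm_triangle_ineq)
    then have "(2 * norm (x + r *\<^sub>R (y + z)) - 2 * norm x) / (2 * r)
        \<le> (norm (x + (2 * r) *\<^sub>R y) + norm (x + (2 * r) *\<^sub>R z) - 2 * norm x) / (2 * r)"
      using r(1) by (intro divide_right_mono) auto
    then have "?q r (y + z) \<le> ?q (2 * r) y + ?q (2 * r) z"
      by (simp add: add_divide_distrib diff_divide_distrib)
    moreover have "?q (2 * r) y \<le> ?q t y" "?q (2 * r) z \<le> ?q t' z"
      using r by (auto intro!: norm_quotient_mono)
    ultimately show ?thesis using norm_dderiv_le[OF r(1), of x "y + z"] by linarith
  qed
  \<comment> \<open>The two infima are taken one after the other: for fixed t over t', then over
    t.\<close>
  have "norm_dderiv x (y + z) - norm_dderiv x z \<le> norm_dderiv x y"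
  proof (rule norm_dderiv_greatest)
    fix t :: real assume t: "0 < t"
    have "norm_dderiv x (y + z) - ?q t y \<le> norm_dderiv x z"
      by (rule norm_dderiv_greatest) (use *[OF t] in \<open>simp add: algebra_simps\<close>)
    then show "norm_dderiv x (y + z) - norm_dderiv x z \<le> ?q t y" by simp
  qed
  then show ?thesis by simp
qed

text \<open>Every norming functional of x is hence dominated by \<open>norm_dderiv x\<close>, which
  is what makes it unique.\<close>

lemma norm_functional_le_quotient:
  fixes p :: "'a::real_normed_vector \<Rightarrow>\<^sub>L real"
  assumes "norm p \<le> 1" "blinfun_apply p x = norm x" "0 < t"
  shows "blinfun_apply p y \<le> (norm (x + t *\<^sub>R y) - norm x) / t"
proof -
  have "blinfun_apply p (x + t *\<^sub>R y) \<le> norm p * norm (x + t *\<^sub>R y)"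
    using norm_blinfun[of p "x + t *\<^sub>R y"] by simp
  also have "\<dots> \<le> norm (x + t *\<^sub>R y)"
    using assms(1) by (simp add: mult_left_le_one_le)
  finally have "norm x + t * blinfun_apply p y \<le> norm (x + t *\<^sub>R y)"
    by (simp add: blinfun.add_right blinfun.scaleR_right assms(2))
  then show ?thesis using assms(3) by (simp add: field_simps)
qed

lemma blinfun_apply_le_norm:
  fixes p :: "'a::real_normed_vector \<Rightarrow>\<^sub>L real"
  assumes "norm p \<le> 1"
  shows "blinfun_apply p y \<le> norm y"
proof -
  have "blinfun_apply p y \<le> norm p * norm y" using norm_blinfun[of p y] by simp
  also have "\<dots> \<le> norm y" using assms by (simp add: mult_left_le_one_le)
  finally show ?thesis .
qed

text \<open>The bound on the modulus of smoothness in homogeneous form: unit vectors are replaced by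
  arbitrary non-zero x, with \<tau> = norm y / norm x and both sides multiplied by norm x.\<close>

locale power_smooth =
  fixes X :: "'a::real_normed_vector itself" and C s :: real
  assumes C_pos: "0 < C" and s_gt_1: "1 < s"
    and smooth: "\<And>x y :: 'a. x \<noteq> 0 \<Longrightarrow>
      norm (x + y) + norm (x - y) \<le> 2 * norm x + 2 * C * norm x * (norm y / norm x) powr s"
begin

text \<open>Subadditivity makes the sum of the two derivatives non-negative. Smoothness bounds the
  sum of the quotients at y and - y by K t^(s - 1), which tends to 0 because s > 1. This turns the
  sublinear \<open>norm_dderiv x\<close> into a linear functional.\<close>

lemma norm_dderiv_minus:
  fixes x y :: 'a
  assumes "x \<noteq> 0"
  shows "norm_dderiv x (- y) = - norm_dderiv x y"
proof -
  have "norm_dderiv x 0 = 0"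
    using abs_norm_dderiv_le[of x 0] by simp
  then have 1: "0 \<le> norm_dderiv x y + norm_dderiv x (- y)"
    using norm_dderiv_add_le[of x y "- y"] by simp
  define K where "K = 2 * C * norm x * (norm y / norm x) powr s"
  have "norm_dderiv x y + norm_dderiv x (- y) \<le> K * t powr (s - 1)" if t: "0 < t" for t
  proof -
    have "norm (x + t *\<^sub>R y) + norm (x - t *\<^sub>R y) \<le> 2 * norm x + 2 * C * norm x * (norm (t *\<^sub>R y) / norm x) powr s"
      by (rule smooth) fact
    also have "(norm (t *\<^sub>R y) / norm x) powr s = t * t powr (s - 1) * (norm y / norm x) powr s"
    proof -
      have "norm (t *\<^sub>R y) / norm x = t * (norm y / norm x)" using t by simp
      moreover have "(t * (norm y / norm x)) powr s = t powr s * (norm y / norm x) powr s"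
        using t powr_mult[of t "norm y / norm x" s] by simp
      moreover have "t powr s = t * t powr (s - 1)"
        using t powr_add[of t 1 "s - 1"] by simp
      ultimately show ?thesis by metis
    qed
    finally have "(norm (x + t *\<^sub>R y) + norm (x - t *\<^sub>R y) - 2 * norm x) / t \<le> K * t powr (s - 1)"
      using t by (simp add: pos_divide_le_eq K_def mult_ac)
    then have "(norm (x + t *\<^sub>R y) - norm x) / t + (norm (x + t *\<^sub>R (- y)) - norm x) / t \<le> K * t powr (s - 1)"
      by (simp add: add_divide_distrib diff_divide_distrib)
    then show ?thesis
      using norm_dderiv_le[OF t, of x y] norm_dderiv_le[OF t, of x "- y"] by linarith
  qed
  then have ev: "\<forall>\<^sub>F t in at_right 0. norm_dderiv x y + norm_dderiv x (- y) \<le> K * t powr (s - 1)"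
    by (auto simp: eventually_at_filter intro!: always_eventually)
  have "((\<lambda>t. K * t powr (s - 1)) \<longlongrightarrow> K * 0 powr (s - 1)) (at_right 0)"
    using s_gt_1 by (intro tendsto_intros) (auto simp: eventually_at_filter)
  then have "norm_dderiv x y + norm_dderiv x (- y) \<le> 0"
    using tendsto_lowerbound[OF _ ev] by simp
  then show ?thesis using 1 by linarith
qed

lemma norm_dderiv_add:
  fixes x y z :: 'a
  assumes "x \<noteq> 0"
  shows "norm_dderiv x (y + z) = norm_dderiv x y + norm_dderiv x z"
  using norm_dderiv_add_le[of x y z] norm_dderiv_add_le[of x "y + z" "- z"]
  by (simp add: norm_dderiv_minus[OF assms])

lemma bounded_linear_norm_dderiv:
  fixes x :: 'a
  assumes "x \<noteq> 0"
  shows "bounded_linear (norm_dderiv x)"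
proof (rule bounded_linear_intro[where K = 1])
  show "norm_dderiv x (y + z) = norm_dderiv x y + norm_dderiv x z" for y z
    using norm_dderiv_add[OF assms] .
  show "norm (norm_dderiv x y) \<le> norm y * 1" for y
    using abs_norm_dderiv_le by simp
  show "norm_dderiv x (c *\<^sub>R y) = c *\<^sub>R norm_dderiv x y" for c y
  proof (cases c "0 :: real" rule: linorder_cases)
    case less
    then show ?thesis
      using norm_dderiv_minus[OF assms, of "(- c) *\<^sub>R y"] norm_dderiv_scale[of "- c" x y] by simp
  next
    case equal
    then show ?thesis using abs_norm_dderiv_le[of x 0] by simp
  next
    case greater
    then show ?thesis by (simp add: norm_dderiv_scale)
  qed
qed

lemma norm_dderiv_self: "norm_dderiv x (x :: 'a) = norm x"
proof -
  have q: "(norm (x + t *\<^sub>R x) - norm x) / t = norm x" if "0 < t" for t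
  proof -
    have "x + t *\<^sub>R x = (1 + t) *\<^sub>R x" by (simp add: algebra_simps)
    then have "norm (x + t *\<^sub>R x) = (1 + t) * norm x" using that by (metis abs_of_pos add_pos_pos norm_scaleR zero_less_one)
    then show ?thesis using that by (simp add: field_simps)
  qed
  then have "norm_dderiv x x \<le> norm x" using norm_dderiv_le[of 1 x x] q[of 1] by simp
  moreover have "norm x \<le> norm_dderiv x x" by (rule norm_dderiv_greatest) (simp add: q)
  ultimately show ?thesis by simp
qed

text \<open>A norming functional r lies below the linear functional \<open>norm_dderiv x\<close>;
  applying this at y and at - y forces equality. Existence and uniqueness together justify the
  definite description in \<open>norming_functional\<close>.\<close>

lemma norming_functional_props:
  fixes x :: 'a
  assumes x: "x \<noteq> 0"
  shows norm_norming_functional: "norm (norming_functional x) = 1"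
    and norming_functional_self: "blinfun_apply (norming_functional x) x = norm x"
proof -
  define p where "p = Blinfun (norm_dderiv x)"
  have p: "blinfun_apply p = norm_dderiv x"
    by (simp add: p_def bounded_linear_Blinfun_apply bounded_linear_norm_dderiv[OF x])
  have "norm p = 1"
  proof (rule norm_blinfun_eqI[where x = x])
    show "1 \<le> norm (blinfun_apply p x) / norm x" using x by (simp add: p norm_dderiv_self)
    show "norm (blinfun_apply p y) \<le> 1 * norm y" for y using abs_norm_dderiv_le by (simp add: p)
  qed simp
  moreover have "blinfun_apply p x = norm x" by (simp add: p norm_dderiv_self)
  moreover have "r = p" if r: "norm r = 1" "blinfun_apply r x = norm x" for r
  proof (rule blinfun_eqI)
    have le: "blinfun_apply r y \<le> blinfun_apply p y" for y
      unfolding p using r by (intro norm_dderiv_greatest norm_functional_le_quotient) auto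
    show "blinfun_apply r y = blinfun_apply p y" for y
      using le[of y] le[of "- y"] by (simp add: blinfun.minus_right)
  qed
  ultimately have "\<exists>!p. norm p = 1 \<and> blinfun_apply p x = norm x" by blast
  from theI'[OF this] show "norm (norming_functional x) = 1"
    and "blinfun_apply (norming_functional x) x = norm x"
    by (auto simp: norming_functional_def)
qed

text \<open>In the smoothness inequality norm (x - y) is bounded below by the value norm x - p y of
  the norming functional p. The result is a first-order expansion of the norm at x with a one-sided
  remainder of order s.\<close>

lemma norm_add_le_smooth:
  fixes x y :: 'a
  assumes x: "x \<noteq> 0"
  shows "norm (x + y) \<le> norm x + blinfun_apply (norming_functional x) y
           + 2 * C * norm x * (norm y / norm x) powr s"
proof -
  have "blinfun_apply (norming_functional x) (x - y) \<le> norm (x - y)"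
    by (rule blinfun_apply_le_norm) (simp add: norm_norming_functional[OF x])
  then show ?thesis
    using smooth[OF x, of y] by (simp add: blinfun.diff_right norming_functional_self[OF x])
qed

end

text \<open>Dividing by norm x reduces the claim to a unit vector. The maximum with 1 makes the
  constant positive.\<close>

lemma smoothness_power_type_imp_power_smooth:
  assumes "smoothness_power_type TYPE('a::real_normed_vector) s" "1 < s"
  obtains C where "power_smooth TYPE('a) C s"
proof -
  obtain C0 where C0: "\<And>\<tau>. 0 \<le> \<tau> \<Longrightarrow> modulus_of_smoothness TYPE('a) \<tau> \<le> C0 * \<tau> powr s"
    using assms(1) unfolding smoothness_power_type_def by blast
  define C where "C = max C0 1"
  have "power_smooth TYPE('a) C s"
  proof
    show "0 < C" by (simp add: C_def)
    show "1 < s" by fact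
    fix x y :: 'a assume x: "x \<noteq> 0"
    define e where "e = x /\<^sub>R norm x"
    define w where "w = y /\<^sub>R norm x"
    define \<tau> where "\<tau> = norm y / norm x"
    have ew: "norm e = 1" "norm w = \<tau>" "x = norm x *\<^sub>R e" "y = norm x *\<^sub>R w" "0 \<le> \<tau>"
      using x by (auto simp: e_def w_def \<tau>_def field_simps)
    have "(norm (e + w) + norm (e - w)) / 2 - 1 \<le> modulus_of_smoothness TYPE('a) \<tau>"
      unfolding modulus_of_smoothness_def
    proof (rule cSup_upper)
      show "(norm (e + w) + norm (e - w)) / 2 - 1
        \<in> {(norm (x + y) + norm (x - y)) / 2 - 1 |x y. norm (x :: 'a) = 1 \<and> norm y = \<tau>}"
        using ew by blast
      \<comment> \<open>A real supremum is an upper bound only for a set bounded above; here the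
        triangle inequality gives the bound \<tau>.\<close>
      show "bdd_above {(norm (x + y) + norm (x - y)) / 2 - 1 |x y. norm (x :: 'a) = 1 \<and> norm y = \<tau>}"
      proof (rule bdd_aboveI[where M = \<tau>], clarsimp)
        fix x y :: 'a assume "norm x = 1" "\<tau> = norm y"
        then show "(norm (x + y) + norm (x - y)) / 2 - 1 \<le> norm y"
          using norm_triangle_ineq[of x y] norm_triangle_ineq4[of x y] by (simp add: field_simps)
      qed
    qed
    also have "\<dots> \<le> C0 * \<tau> powr s" using C0 ew by simp
    also have "\<dots> \<le> C * \<tau> powr s" by (simp add: C_def mult_right_mono)
    finally have *: "norm (e + w) + norm (e - w) \<le> 2 + 2 * C * \<tau> powr s" by (simp add: field_simps)
    have "norm (x + y) + norm (x - y) = norm x * (norm (e + w) + norm (e - w))"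
    proof -
      have "x + y = norm x *\<^sub>R (e + w)" "x - y = norm x *\<^sub>R (e - w)"
        using ew by (metis scaleR_add_right, metis scaleR_diff_right)
      then show ?thesis by (metis abs_norm_cancel norm_scaleR distrib_left)
    qed
    also have "\<dots> \<le> norm x * (2 + 2 * C * \<tau> powr s)" using * by (simp add: mult_left_mono)
    finally show "norm (x + y) + norm (x - y) \<le> 2 * norm x + 2 * C * norm x * (norm y / norm x) powr s"
      by (simp add: \<tau>_def algebra_simps)
  qed
  then show thesis by (rule that)
qed

section \<open>Differentiability of the distance, the metric projection, and balls missing A\<close>

subsection \<open>Proximally smooth sets: metric projection and supporting balls\<close>

text \<open>If one functional of norm at most 1 exceeds 1 - \<delta> on both unit vectors, it does
  so on their midpoint, whose norm is then too large for vectors at distance \<epsilon> or more. The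
  \<delta> does not depend on the functional.\<close>

lemma uniformly_convex_functional:
  assumes "uniformly_convex_space TYPE('a::real_normed_vector)" "0 < \<epsilon>"
  obtains \<delta> where "0 < \<delta>"
    "\<And>(p :: 'a \<Rightarrow>\<^sub>L real) e v. norm p \<le> 1 \<Longrightarrow> norm e = 1 \<Longrightarrow> norm v = 1 \<Longrightarrow>
      1 - \<delta> < blinfun_apply p e \<Longrightarrow> 1 - \<delta> < blinfun_apply p v \<Longrightarrow> norm (e - v) < \<epsilon>"
proof -
  obtain \<delta> where \<delta>: "0 < \<delta>" "\<And>x y :: 'a. norm x = 1 \<Longrightarrow> norm y = 1 \<Longrightarrow> \<epsilon> \<le> norm (x - y) \<Longrightarrow>
      norm ((x + y) /\<^sub>R 2) \<le> 1 - \<delta>"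
    using assms unfolding uniformly_convex_space_def by meson
  show thesis
  proof (rule that[OF \<delta>(1)])
    fix p :: "'a \<Rightarrow>\<^sub>L real" and e v :: 'a
    assume *: "norm p \<le> 1" "norm e = 1" "norm v = 1"
      "1 - \<delta> < blinfun_apply p e" "1 - \<delta> < blinfun_apply p v"
    show "norm (e - v) < \<epsilon>"
    proof (rule ccontr)
      assume "\<not> norm (e - v) < \<epsilon>"
      then have "norm ((e + v) /\<^sub>R 2) \<le> 1 - \<delta>" using * by (intro \<delta>(2)) auto
      moreover have "blinfun_apply p ((e + v) /\<^sub>R 2) \<le> norm ((e + v) /\<^sub>R 2)"
        by (rule blinfun_apply_le_norm) fact
      moreover have "blinfun_apply p ((e + v) /\<^sub>R 2) = (blinfun_apply p e + blinfun_apply p v) / 2"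
        by (simp add: blinfun.add_right blinfun.scaleR_right)
      ultimately show False using * by (simp add: field_simps)
    qed
  qed
qed

text \<open>Starting at x, one moves repeatedly to a point reachable with slope at least \<kappa>
  and nearly as high as possible. Each distance is at most the gain in f divided by \<kappa>, and
  the total gain is bounded, so the points converge. A limit below level r would admit one more
  step, contradicting the near-maximal choices.\<close>

lemma steep_ascent:
  fixes f :: "'a::complete_space \<Rightarrow> real"
  assumes cont: "continuous_on UNIV f" and "0 < \<kappa>" and "f x \<le> r"
    and step: "\<And>y. f x \<le> f y \<Longrightarrow> f y < r \<Longrightarrow> \<exists>z. f y < f z \<and> f z \<le> r \<and> f y + \<kappa> * dist z y \<le> f z"
  obtains y where "f y = r" "\<kappa> * dist y x \<le> r - f x"
proof -
  define S where "S y = {z. f z \<le> r \<and> f y + \<kappa> * dist z y \<le> f z}" for y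
  have S_trans: "w \<in> S y" if "z \<in> S y" "w \<in> S z" for w y z
  proof -
    have "\<kappa> * dist w y \<le> \<kappa> * dist w z + \<kappa> * dist z y"
      using \<open>0 < \<kappa>\<close> dist_triangle[of w y z] by (metis distrib_left mult_left_mono order_less_imp_le)
    then show ?thesis using that unfolding S_def by auto
  qed
  have S_ge: "f y \<le> f z" if "z \<in> S y" for y z
  proof -
    have "0 \<le> \<kappa> * dist z y" using \<open>0 < \<kappa>\<close> by simp
    then show ?thesis using that unfolding S_def by auto
  qed
  \<comment> \<open>The inequality says that f w is at least halfway from f y to the supremum of f
    on \<open>S y\<close>. This avoids naming the supremum later.\<close>
  have "\<exists>w. w \<in> S y \<and> (\<forall>z\<in>S y. f z \<le> 2 * f w - f y)" if y: "f y \<le> r" for y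
  proof -
    have yS: "y \<in> S y" using y by (simp add: S_def)
    have bdd: "bdd_above (f ` S y)" by (intro bdd_aboveI[where M = r]) (auto simp: S_def)
    define M where "M = (SUP z\<in>S y. f z)"
    have M: "f z \<le> M" if "z \<in> S y" for z
      unfolding M_def by (rule cSUP_upper[OF that bdd])
    show ?thesis
    proof (cases "f y < M")
      case True
      then have "(f y + M) / 2 < M" by simp
      then obtain w where "w \<in> S y" "(f y + M) / 2 < f w"
        unfolding M_def using less_cSUP_iff[OF _ bdd] yS by blast
      then show ?thesis using M by (intro exI[of _ w]) (force simp: field_simps)
    next
      case False
      then show ?thesis using M yS by (intro exI[of _ y]) force
    qed
  qed
  then obtain F where F: "\<And>y. f y \<le> r \<Longrightarrow> F y \<in> S y"
      "\<And>y z. f y \<le> r \<Longrightarrow> z \<in> S y \<Longrightarrow> f z \<le> 2 * f (F y) - f y"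
    by metis
  define Y where "Y n = (F ^^ n) x" for n
  have Y0: "Y 0 = x" and Y_Suc: "Y (Suc n) = F (Y n)" for n by (simp_all add: Y_def)
  have Y_le: "f (Y n) \<le> r" for n
    by (induction n) (use F(1) \<open>f x \<le> r\<close> in \<open>auto simp: Y0 Y_Suc S_def\<close>)
  have Y_S: "Y (n + k) \<in> S (Y n)" for n k
  proof (induction k)
    case 0
    show ?case using Y_le by (simp add: S_def)
  next
    case (Suc k)
    then show ?case using S_trans F(1)[OF Y_le] by (simp add: Y_Suc)
  qed
  have inc: "incseq (\<lambda>n. f (Y n))"
    using S_ge Y_S by (metis incseq_def le_Suc_ex)
  then obtain m where m: "(\<lambda>n. f (Y n)) \<longlonglongrightarrow> m"
    using incseq_convergent[of "\<lambda>n. f (Y n)" r] Y_le by metis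
  have "Cauchy Y"
  proof (rule metric_CauchyI)
    fix e :: real assume "0 < e"
    then have "0 < \<kappa> * e" using \<open>0 < \<kappa>\<close> by simp
    then obtain N where N: "\<And>k n. N \<le> k \<Longrightarrow> N \<le> n \<Longrightarrow> dist (f (Y k)) (f (Y n)) < \<kappa> * e"
      using LIMSEQ_imp_Cauchy[OF m] unfolding Cauchy_def by blast
    have *: "dist (Y (n + k)) (Y n) < e" if "N \<le> n" for n k
    proof -
      have "\<kappa> * dist (Y (n + k)) (Y n) \<le> f (Y (n + k)) - f (Y n)"
        using Y_S[of n k] by (simp add: S_def)
      also have "\<dots> < \<kappa> * e" using N[of "n + k" n] that by (simp add: dist_real_def)
      finally show ?thesis using \<open>0 < \<kappa>\<close> by simp
    qed
    show "\<exists>N. \<forall>k\<ge>N. \<forall>n\<ge>N. dist (Y k) (Y n) < e"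
    proof (intro exI allI impI)
      fix k n assume "N \<le> k" "N \<le> n"
      then show "dist (Y k) (Y n) < e"
        using *[of n "k - n"] *[of k "n - k"] by (cases "n \<le> k") (auto simp: dist_commute)
    qed
  qed
  then obtain y where y: "Y \<longlonglongrightarrow> y" using Cauchy_convergent convergent_def by blast
  have fy: "(\<lambda>n. f (Y n)) \<longlonglongrightarrow> f y"
    using cont y by (simp add: continuous_on_tendsto_compose)
  have y_S: "y \<in> S (Y n)" for n
  proof -
    have "f y \<le> r" using fy Y_le by (intro LIMSEQ_le_const2) auto
    moreover have "f (Y n) + \<kappa> * dist y (Y n) \<le> f y"
    proof (rule LIMSEQ_le[OF _ fy])
      show "(\<lambda>k. f (Y n) + \<kappa> * dist (Y k) (Y n)) \<longlonglongrightarrow> f (Y n) + \<kappa> * dist y (Y n)"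
        by (intro tendsto_intros y)
      show "\<exists>N. \<forall>k\<ge>N. f (Y n) + \<kappa> * dist (Y k) (Y n) \<le> f (Y k)"
        using Y_S[of n] unfolding S_def by (metis (no_types, lifting) le_Suc_ex mem_Collect_eq)
    qed
    ultimately show ?thesis by (simp add: S_def)
  qed
  have "f y = r"
  proof (rule ccontr)
    assume "f y \<noteq> r"
    then have "f y < r" using y_S[of 0] by (simp add: S_def)
    moreover have "f x \<le> f y" using S_ge[OF y_S[of 0]] by (simp add: Y0)
    ultimately obtain z where z: "f y < f z" "z \<in> S y" using step[of y] unfolding S_def by blast
    \<comment> \<open>By transitivity z is reachable from every \<open>Y n\<close>, so each choice
      competed with it; in the limit f z <= f y.\<close>
    have "f z \<le> 2 * f (Y (Suc n)) - f (Y n)" for n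
      unfolding Y_Suc by (rule F(2)[OF Y_le S_trans[OF y_S z(2)]])
    moreover have "(\<lambda>n. 2 * f (Y (Suc n)) - f (Y n)) \<longlonglongrightarrow> 2 * f y - f y"
      by (intro tendsto_intros fy LIMSEQ_Suc)
    ultimately have "f z \<le> 2 * f y - f y" by (intro LIMSEQ_le_const) auto
    then show False using z(1) by simp
  qed
  then show thesis using that y_S[of 0] unfolding S_def Y0 by auto
qed

text \<open>The derivative \<open>D\<close> is a parameter, so that it can be used as a functional
  nearly attaining its norm at directions to near-minimizers. Non-emptiness of A excludes the
  default value 0 of \<open>infdist\<close> for the empty set.\<close>

locale proximal_set = power_smooth X C s for X :: "'a::banach itself" and C s +
  fixes R :: real and A :: "'a set" and D :: "'a \<Rightarrow> 'a \<Rightarrow>\<^sub>L real"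
  assumes uconvex: "uniformly_convex_space TYPE('a)"
    and closed_A: "closed A" and A_ne: "A \<noteq> {}"
    and infdist_deriv: "\<And>x. 0 < infdist x A \<Longrightarrow> infdist x A < R \<Longrightarrow>
      ((\<lambda>z. infdist z A) has_derivative blinfun_apply (D x)) (at x)"
begin

abbreviation d :: "'a \<Rightarrow> real" where "d x \<equiv> infdist x A"

lemma d_lipschitz: "d (x + h) \<le> d x + norm h" "d x - norm h \<le> d (x + h)"
  using infdist_triangle[of "x + h" A x] infdist_triangle[of x A "x + h"] by (simp_all add: dist_norm)

lemma d_le: "a \<in> A \<Longrightarrow> d x \<le> norm (x - a)"
  by (metis dist_norm infdist_le)

lemma d_expansion:
  assumes "0 < d x" "d x < R" "0 < \<epsilon>"
  obtains \<delta> where "0 < \<delta>" "\<And>h. norm h < \<delta> \<Longrightarrow> \<bar>d (x + h) - d x - blinfun_apply (D x) h\<bar> \<le> \<epsilon> * norm h"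
proof -
  obtain \<delta> where "0 < \<delta>" and \<delta>: "\<And>y. norm (y - x) < \<delta> \<Longrightarrow>
      norm (d y - d x - blinfun_apply (D x) (y - x)) \<le> \<epsilon> * norm (y - x)"
    using infdist_deriv[OF assms(1,2)] assms(3) unfolding has_derivative_at_alt by blast
  show thesis
    by (rule that[OF \<open>0 < \<delta>\<close>]) (use \<delta>[of "x + _"] in simp)
qed

text \<open>The distance function is 1-Lipschitz, so its difference quotients in direction h are at
  most norm h.\<close>

lemma norm_D_le:
  assumes "0 < d x" "d x < R"
  shows "norm (D x) \<le> 1"
proof (rule norm_blinfun_bound)
  have le: "blinfun_apply (D x) h \<le> norm h" for h
  proof (cases "h = 0")
    case False
    show ?thesis
    proof (rule field_le_epsilon)
      fix e :: real assume "0 < e"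
      then have "0 < e / norm h" using False by simp
      then obtain \<delta> where \<delta>: "0 < \<delta>"
        "\<And>k. norm k < \<delta> \<Longrightarrow> \<bar>d (x + k) - d x - blinfun_apply (D x) k\<bar> \<le> e / norm h * norm k"
        using d_expansion[OF assms] by metis
      define t where "t = \<delta> / (2 * norm h)"
      have t: "0 < t" "norm (t *\<^sub>R h) < \<delta>" using \<delta>(1) False by (auto simp: t_def)
      have "\<bar>d (x + t *\<^sub>R h) - d x - t * blinfun_apply (D x) h\<bar> \<le> t * e"
        using \<delta>(2)[OF t(2)] t(1) False by (simp add: blinfun.scaleR_right mult.commute)
      moreover have "d (x + t *\<^sub>R h) \<le> d x + t * norm h"
        using d_lipschitz(1)[of x "t *\<^sub>R h"] t by simp
      ultimately have "t * blinfun_apply (D x) h \<le> t * norm h + t * e" by linarith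
      then have "t * blinfun_apply (D x) h \<le> t * (norm h + e)" by (simp add: distrib_left)
      then show "blinfun_apply (D x) h \<le> norm h + e" using t(1) by simp
    qed
  qed simp
  show "norm (blinfun_apply (D x) h) \<le> 1 * norm h" for h
    using le[of h] le[of "- h"] by (simp add: blinfun.minus_right)
qed simp

text \<open>A step of length t from x towards a near-minimizer a lowers the distance by almost t.
  Comparison with the linear expansion shows that the derivative is almost 1 in the direction from a
  to x.\<close>

lemma near_minimizer_direction:
  assumes "0 < d x" "d x < R" "0 < \<eta>"
  obtains \<delta> where "0 < \<delta>" "\<And>a. a \<in> A \<Longrightarrow> norm (x - a) < d x + \<delta> \<Longrightarrow>
      1 - \<eta> < blinfun_apply (D x) ((x - a) /\<^sub>R norm (x - a))"
proof -
  obtain \<delta>' where \<delta>': "0 < \<delta>'"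
    "\<And>h. norm h < \<delta>' \<Longrightarrow> \<bar>d (x + h) - d x - blinfun_apply (D x) h\<bar> \<le> \<eta> / 2 * norm h"
    using d_expansion[OF assms(1,2), of "\<eta> / 2"] assms(3) by auto
  \<comment> \<open>The bound by d x keeps the step from passing a. The expansion error and the
    excess of norm (x - a) over d x each contribute at most \<eta> t / 2.\<close>
  define t where "t = min (\<delta>' / 2) (d x)"
  have t: "0 < t" "t < \<delta>'" "t \<le> d x" using \<delta>'(1) assms by (auto simp: t_def)
  show thesis
  proof (rule that[of "\<eta> * t / 2"])
    show "0 < \<eta> * t / 2" using t assms by simp
    fix a assume a: "a \<in> A" "norm (x - a) < d x + \<eta> * t / 2"
    define u where "u = (x - a) /\<^sub>R norm (x - a)"
    have xa: "t \<le> norm (x - a)" "0 < norm (x - a)" using d_le[OF a(1), of x] t by linarith+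
    then have u: "norm u = 1" "x - a = norm (x - a) *\<^sub>R u" by (auto simp: u_def)
    have "x + (- t) *\<^sub>R u - a = (norm (x - a) - t) *\<^sub>R u"
      using u(2) by (simp add: scaleR_left_diff_distrib algebra_simps)
    then have "norm (x + (- t) *\<^sub>R u - a) = norm (x - a) - t" using u xa by simp
    then have "d (x + (- t) *\<^sub>R u) \<le> norm (x - a) - t" using d_le[OF a(1)] by metis
    moreover have "\<bar>d (x + (- t) *\<^sub>R u) - d x + t * blinfun_apply (D x) u\<bar> \<le> \<eta> * t / 2"
      using \<delta>'(2)[of "(- t) *\<^sub>R u"] t u by (simp add: blinfun.scaleR_right blinfun.minus_right)
    ultimately have "t - \<eta> * t < t * blinfun_apply (D x) u"
      using a(2) unfolding abs_le_iff by linarith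
    then have "t * (1 - \<eta>) < t * blinfun_apply (D x) u" by (simp add: algebra_simps)
    then show "1 - \<eta> < blinfun_apply (D x) ((x - a) /\<^sub>R norm (x - a))"
      using t(1) by (simp add: u_def)
  qed
qed

text \<open>Off A, the directions from two near-minimizers to x almost norm the same functional
  \<open>D x\<close>, so uniform convexity makes them close, and both points lie at nearly the same
  distance from x. If d x = 0 there is no derivative to use, and the triangle inequality
  suffices.\<close>

lemma near_minimizers_close:
  assumes "d x < R" "0 < \<epsilon>"
  obtains \<delta> where "0 < \<delta>" "\<And>a b. a \<in> A \<Longrightarrow> b \<in> A \<Longrightarrow> norm (x - a) < d x + \<delta> \<Longrightarrow>
      norm (x - b) < d x + \<delta> \<Longrightarrow> norm (a - b) < \<epsilon>"
proof (cases "d x = 0")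
  case True
  show thesis
  proof (rule that[of "\<epsilon> / 2"])
    fix a b assume "norm (x - a) < d x + \<epsilon> / 2" "norm (x - b) < d x + \<epsilon> / 2"
    then show "norm (a - b) < \<epsilon>"
      using True norm_triangle_ineq4[of "x - b" "x - a"] by (simp add: field_simps)
  qed (use assms in simp)
next
  case False
  then have dx: "0 < d x" using infdist_nonneg[of x A] by linarith
  then have "0 < \<epsilon> / (2 * d x)" using assms by simp
  then obtain \<eta> where \<eta>: "0 < \<eta>" "\<And>(p :: 'a \<Rightarrow>\<^sub>L real) e v. norm p \<le> 1 \<Longrightarrow> norm e = 1 \<Longrightarrow> norm v = 1 \<Longrightarrow>
      1 - \<eta> < blinfun_apply p e \<Longrightarrow> 1 - \<eta> < blinfun_apply p v \<Longrightarrow> norm (e - v) < \<epsilon> / (2 * d x)"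
    using uniformly_convex_functional[OF uconvex] by metis
  obtain \<delta> where \<delta>: "0 < \<delta>" "\<And>a. a \<in> A \<Longrightarrow> norm (x - a) < d x + \<delta> \<Longrightarrow>
      1 - \<eta> < blinfun_apply (D x) ((x - a) /\<^sub>R norm (x - a))"
    using near_minimizer_direction[OF dx assms(1) \<eta>(1)] by metis
  show thesis
  proof (rule that[of "min \<delta> (\<epsilon> / 4)"])
    show "0 < min \<delta> (\<epsilon> / 4)" using \<delta> assms by simp
    fix a b assume ab: "a \<in> A" "b \<in> A" "norm (x - a) < d x + min \<delta> (\<epsilon> / 4)"
      "norm (x - b) < d x + min \<delta> (\<epsilon> / 4)"
    define u where "u = (x - a) /\<^sub>R norm (x - a)"
    define v where "v = (x - b) /\<^sub>R norm (x - b)"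
    have ge: "d x \<le> norm (x - a)" "d x \<le> norm (x - b)" using ab d_le by auto
    then have "norm (x - a) \<noteq> 0" "norm (x - b) \<noteq> 0" using dx by linarith+
    then have uv: "norm u = 1" "x - a = norm (x - a) *\<^sub>R u" "norm v = 1" "x - b = norm (x - b) *\<^sub>R v"
      by (simp_all add: u_def v_def)
    have "norm (u - v) < \<epsilon> / (2 * d x)"
      using norm_D_le[OF dx assms(1)] uv \<delta>(2) ab by (intro \<eta>(2)[of "D x"]) (auto simp: u_def v_def)
    then have "d x * norm (u - v) < \<epsilon> / 2" using dx by (simp add: field_simps)
    moreover have "a - b = ((norm (x - b) - d x) *\<^sub>R v - (norm (x - a) - d x) *\<^sub>R u) - d x *\<^sub>R (u - v)"
      using uv by (simp add: algebra_simps)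
    then have "norm (a - b) \<le> (norm (x - b) - d x) + (norm (x - a) - d x) + d x * norm (u - v)"
      using norm_triangle_ineq4[of "(norm (x - b) - d x) *\<^sub>R v - (norm (x - a) - d x) *\<^sub>R u" "d x *\<^sub>R (u - v)"]
        norm_triangle_ineq4[of "(norm (x - b) - d x) *\<^sub>R v" "(norm (x - a) - d x) *\<^sub>R u"] uv ge dx
      by simp
    ultimately show "norm (a - b) < \<epsilon>" using ab by linarith
  qed
qed

text \<open>A minimizing sequence is Cauchy by \<open>near_minimizers_close\<close>, and its limit
  lies in the closed set A. The same lemma, with \<epsilon> the distance of two minimizers, gives
  uniqueness.\<close>

lemma metric_projection_exists:
  assumes "d x < R"
  obtains a where "metric_projection A x = {a}"
proof -
  have "\<exists>a\<in>A. norm (x - a) < d x + inverse (real (Suc n))" for n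
  proof -
    have "(INF a\<in>A. dist x a) < d x + inverse (real (Suc n))"
      using infdist_notempty[OF A_ne, of x] by simp
    then show ?thesis using cINF_less_iff[OF A_ne bdd_below_image_dist] by (auto simp: dist_norm)
  qed
  then obtain a where a: "\<And>n. a n \<in> A" "\<And>n. norm (x - a n) < d x + inverse (real (Suc n))" by metis
  have "Cauchy a"
  proof (rule metric_CauchyI)
    fix \<epsilon> :: real assume "0 < \<epsilon>"
    then obtain \<delta> where \<delta>: "0 < \<delta>" "\<And>a b. a \<in> A \<Longrightarrow> b \<in> A \<Longrightarrow> norm (x - a) < d x + \<delta> \<Longrightarrow>
      norm (x - b) < d x + \<delta> \<Longrightarrow> norm (a - b) < \<epsilon>"
      using near_minimizers_close[OF assms] by metis
    obtain N where N: "inverse (real (Suc N)) < \<delta>" using reals_Archimedean[OF \<delta>(1)] by blast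
    have "norm (x - a n) < d x + \<delta>" if "N \<le> n" for n
    proof -
      have "inverse (real (Suc n)) \<le> inverse (real (Suc N))" using that by simp
      then show ?thesis using a(2)[of n] N by linarith
    qed
    then show "\<exists>N. \<forall>m\<ge>N. \<forall>n\<ge>N. dist (a m) (a n) < \<epsilon>"
      using \<delta>(2) a(1) by (auto simp: dist_norm intro!: exI[of _ N])
  qed
  then obtain l where l: "a \<longlonglongrightarrow> l" using Cauchy_convergent convergent_def by blast
  have lA: "l \<in> A" using closed_A a(1) l closed_sequentially by blast
  have "norm (x - l) \<le> d x"
  proof (rule LIMSEQ_le)
    show "(\<lambda>n. norm (x - a n)) \<longlonglongrightarrow> norm (x - l)" by (intro tendsto_intros l)
    show "(\<lambda>n. d x + inverse (real (Suc n))) \<longlonglongrightarrow> d x"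
      using tendsto_add[OF tendsto_const LIMSEQ_inverse_real_of_nat, of "d x"] by simp
    show "\<exists>N. \<forall>n\<ge>N. norm (x - a n) \<le> d x + inverse (real (Suc n))"
      using a(2) less_imp_le by blast
  qed
  then have "norm (l - x) = d x" using d_le[OF lA, of x] by (simp add: norm_minus_commute)
  then have l_mp: "l \<in> metric_projection A x" using lA by (simp add: metric_projection_def)
  moreover have "b = l" if b: "b \<in> metric_projection A x" for b
  proof (rule ccontr)
    assume "b \<noteq> l"
    then have "0 < norm (b - l)" by simp
    then obtain \<delta> where "0 < \<delta>" "\<And>a c. a \<in> A \<Longrightarrow> c \<in> A \<Longrightarrow> norm (x - a) < d x + \<delta> \<Longrightarrow>
      norm (x - c) < d x + \<delta> \<Longrightarrow> norm (a - c) < norm (b - l)"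
      using near_minimizers_close[OF assms] by metis
    from this(1) this(2)[of b l] b l_mp show False
      by (simp add: metric_projection_def norm_minus_commute)
  qed
  ultimately show thesis using that by blast
qed

definition proj :: "'a \<Rightarrow> 'a" where "proj x = the_elem (metric_projection A x)"

lemma metric_projection_eq: "d x < R \<Longrightarrow> metric_projection A x = {proj x}"
  using metric_projection_exists[of x] unfolding proj_def by (metis the_elem_eq)

lemma proj_in: "d x < R \<Longrightarrow> proj x \<in> A"
  and norm_proj: "d x < R \<Longrightarrow> norm (x - proj x) = d x"
  using metric_projection_eq[of x] by (auto simp: metric_projection_def norm_minus_commute)

lemma proj_self:
  assumes "a \<in> A" "0 < R"
  shows "proj a = a"
  using norm_proj[of a] assms by simp

text \<open>For y near x, the point \<open>proj y\<close> is a near-minimizer for x: its distance to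
  x is at most d x + 2 norm (x - y), hence the radius \<delta> / 2.\<close>

lemma continuous_on_proj: "continuous_on {x. d x < R} proj"
  unfolding continuous_on_iff
proof (intro ballI allI impI)
  fix x \<epsilon> assume "x \<in> {x. d x < R}" "(0::real) < \<epsilon>"
  then have x: "d x < R" by simp
  then obtain \<delta> where \<delta>: "0 < \<delta>" "\<And>a b. a \<in> A \<Longrightarrow> b \<in> A \<Longrightarrow> norm (x - a) < d x + \<delta> \<Longrightarrow>
      norm (x - b) < d x + \<delta> \<Longrightarrow> norm (a - b) < \<epsilon>"
    using near_minimizers_close[OF _ \<open>0 < \<epsilon>\<close>] by metis
  show "\<exists>\<delta>>0. \<forall>x'\<in>{x. d x < R}. dist x' x < \<delta> \<longrightarrow> dist (proj x') (proj x) < \<epsilon>"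
  proof (intro exI[of _ "\<delta> / 2"] conjI ballI impI)
    fix y assume "y \<in> {x. d x < R}" and yx: "dist y x < \<delta> / 2"
    then have y: "d y < R" by simp
    have "norm (x - proj y) \<le> norm (x - y) + norm (y - proj y)"
      using norm_triangle_ineq[of "x - y" "y - proj y"] by simp
    also have "norm (y - proj y) \<le> d x + norm (y - x)"
      using norm_proj[OF y] infdist_triangle[of y A x] by (simp add: dist_norm)
    finally have "norm (x - proj y) < d x + \<delta>"
      using yx by (simp add: dist_norm norm_minus_commute)
    then show "dist (proj y) (proj x) < \<epsilon>"
      unfolding dist_norm using \<delta> x y by (intro \<delta>(2)) (auto simp: proj_in norm_proj)
  qed (use \<delta> in simp)
qed

text \<open>The projection is a near-minimizer for every tolerance, so the estimate of
  \<open>near_minimizer_direction\<close> holds for all \<eta> > 0.\<close>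

lemma D_proj_direction:
  assumes "0 < d x" "d x < R"
  shows "1 \<le> blinfun_apply (D x) ((x - proj x) /\<^sub>R d x)"
proof (rule field_le_epsilon)
  fix \<eta> :: real assume "0 < \<eta>"
  then obtain \<delta> where "0 < \<delta>" "\<And>a. a \<in> A \<Longrightarrow> norm (x - a) < d x + \<delta> \<Longrightarrow>
      1 - \<eta> < blinfun_apply (D x) ((x - a) /\<^sub>R norm (x - a))"
    using near_minimizer_direction[OF assms] by metis
  from this(1) this(2)[of "proj x"] show "1 \<le> blinfun_apply (D x) ((x - proj x) /\<^sub>R d x) + \<eta>"
    using assms by (simp add: norm_proj proj_in)
qed

text \<open>Moving away from the projection raises the distance at rate 1 to first order. This
  supplies the step hypothesis of \<open>steep_ascent\<close> with \<kappa> = 1 -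
  \<epsilon>.\<close>

lemma ascent_step:
  assumes y: "0 < d y" "d y < r" and "r \<le> R" and \<epsilon>: "0 < \<epsilon>" "\<epsilon> < 1"
  shows "\<exists>z. d y < d z \<and> d z \<le> r \<and> d y + (1 - \<epsilon>) * dist z y \<le> d z"
proof -
  have yR: "d y < R" using y assms(3) by simp
  obtain \<delta> where \<delta>: "0 < \<delta>" "\<And>h. norm h < \<delta> \<Longrightarrow> \<bar>d (y + h) - d y - blinfun_apply (D y) h\<bar> \<le> \<epsilon> * norm h"
    using d_expansion[OF y(1) yR \<epsilon>(1)] by metis
  define \<nu> where "\<nu> = (y - proj y) /\<^sub>R d y"
  have \<nu>: "norm \<nu> = 1" using y norm_proj[OF yR] by (simp add: \<nu>_def)
  \<comment> \<open>The first bound keeps the step within the expansion; the second, with the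
    Lipschitz property, keeps it from exceeding level r.\<close>
  define h where "h = min (\<delta> / 2) (r - d y)"
  have h: "0 < h" "h < \<delta>" "h \<le> r - d y" using \<delta> y by (auto simp: h_def)
  have "\<bar>d (y + h *\<^sub>R \<nu>) - d y - h * blinfun_apply (D y) \<nu>\<bar> \<le> \<epsilon> * h"
    using \<delta>(2)[of "h *\<^sub>R \<nu>"] h \<nu> by (simp add: blinfun.scaleR_right)
  moreover have "h * 1 \<le> h * blinfun_apply (D y) \<nu>"
    using D_proj_direction[OF y(1) yR] h by (intro mult_left_mono) (auto simp: \<nu>_def)
  ultimately have *: "d y + (1 - \<epsilon>) * h \<le> d (y + h *\<^sub>R \<nu>)" by (simp add: algebra_simps)
  moreover have "0 < (1 - \<epsilon>) * h" using h \<epsilon> by simp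
  ultimately have "d y < d (y + h *\<^sub>R \<nu>)" by linarith
  moreover have "d (y + h *\<^sub>R \<nu>) \<le> r" using d_lipschitz(1)[of y "h *\<^sub>R \<nu>"] h \<nu> by simp
  moreover have "dist (y + h *\<^sub>R \<nu>) y = h" using h \<nu> by (simp add: dist_norm)
  ultimately show ?thesis using * by (intro exI[of _ "y + h *\<^sub>R \<nu>"]) simp
qed

text \<open>Steep ascent reaches level r at a point y whose distance h from x barely exceeds k = r -
  d x. Since y - proj x has norm at least r = k + d x, the triangle inequality for the path from
  proj x through x to y is almost an equality. A functional norming y - proj x is then almost 1 on
  both unit directions, and uniform convexity makes them almost equal.\<close>

lemma near_ray_at_distance:
  assumes x: "0 < d x" "d x < r" "r < R" and "0 < \<eta>"
  shows "\<exists>y. d y = r \<and> norm (y - (proj x + r *\<^sub>R ((x - proj x) /\<^sub>R d x))) < \<eta>"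
proof -
  have xR: "d x < R" using x by simp
  define \<nu> where "\<nu> = (x - proj x) /\<^sub>R d x"
  have \<nu>: "norm \<nu> = 1" "x - proj x = d x *\<^sub>R \<nu>" using x norm_proj[OF xR] by (auto simp: \<nu>_def)
  define k where "k = r - d x"
  have k: "0 < k" using x by (simp add: k_def)
  then have "0 < \<eta> / (2 * k)" using assms by simp
  then obtain \<delta> where \<delta>: "0 < \<delta>" "\<And>(p :: 'a \<Rightarrow>\<^sub>L real) e v. norm p \<le> 1 \<Longrightarrow> norm e = 1 \<Longrightarrow> norm v = 1 \<Longrightarrow>
      1 - \<delta> < blinfun_apply p e \<Longrightarrow> 1 - \<delta> < blinfun_apply p v \<Longrightarrow> norm (e - v) < \<eta> / (2 * k)"
    using uniformly_convex_functional[OF uconvex] by metis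
  \<comment> \<open>The four bounds give, in turn, h <= 2k, the estimate for p on e, the estimate
    for p on \<nu>, and h - k <= \<eta> / 2.\<close>
  define \<epsilon> where "\<epsilon> = min (min (1 / 2) (\<delta> / 2)) (min (\<delta> * d x / (4 * k)) (\<eta> / (4 * k)))"
  have \<epsilon>0: "0 < \<epsilon>" using \<delta>(1) x k assms by (simp add: \<epsilon>_def)
  have \<epsilon>: "\<epsilon> \<le> 1 / 2" "\<epsilon> \<le> \<delta> / 2" by (auto simp: \<epsilon>_def)
  have "\<epsilon> \<le> \<delta> * d x / (4 * k)" "\<epsilon> \<le> \<eta> / (4 * k)" by (auto simp: \<epsilon>_def)
  then have \<epsilon>k: "2 * k * \<epsilon> \<le> \<delta> * d x / 2" "2 * k * \<epsilon> \<le> \<eta> / 2" using k by (auto simp: field_simps)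
  obtain y where y: "d y = r" "(1 - \<epsilon>) * dist y x \<le> r - d x"
  proof (rule steep_ascent[of d "1 - \<epsilon>" x r])
    show "continuous_on UNIV d" by (intro continuous_intros)
    show "0 < 1 - \<epsilon>" "d x \<le> r" using \<epsilon> x by auto
    show "\<exists>z. d y < d z \<and> d z \<le> r \<and> d y + (1 - \<epsilon>) * dist z y \<le> d z" if "d x \<le> d y" "d y < r" for y
      using that x \<epsilon> \<epsilon>0 by (intro ascent_step) auto
  qed
  define h where "h = norm (y - x)"
  define e where "e = (y - x) /\<^sub>R h"
  have kh: "k \<le> h" using d_lipschitz(1)[of x "y - x"] y by (simp add: h_def k_def)
  have "h \<noteq> 0" using kh k by simp
  then have e: "norm e = 1" "y - x = h *\<^sub>R e" by (simp_all add: e_def) (simp add: h_def)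
  have hk: "(1 - \<epsilon>) * h \<le> k" using y(2) by (simp add: h_def k_def dist_norm)
  have "h - k \<le> 2 * k * \<epsilon>"
  proof -
    have "h \<le> 2 * k"
    proof -
      have "1 / 2 * h \<le> (1 - \<epsilon>) * h" using \<epsilon> kh k by (intro mult_right_mono) auto
      then show ?thesis using hk by linarith
    qed
    then have "\<epsilon> * h \<le> \<epsilon> * (2 * k)" using \<epsilon>0 by (intro mult_left_mono) auto
    then show ?thesis using hk by (simp add: algebra_simps)
  qed
  have ya: "r \<le> norm (y - proj x)" using d_le[OF proj_in[OF xR], of y] y by simp
  then have ne: "y - proj x \<noteq> 0" using x by auto
  define p where "p = norming_functional (y - proj x)"
  have p: "norm p = 1" "blinfun_apply p (y - proj x) = norm (y - proj x)"
    using norming_functional_props[OF ne] by (auto simp: p_def)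
  have "y - proj x = h *\<^sub>R e + d x *\<^sub>R \<nu>" using e \<nu> by (simp add: algebra_simps)
  then have p_sum: "r \<le> h * blinfun_apply p e + d x * blinfun_apply p \<nu>"
    using ya p by (simp add: blinfun.add_right blinfun.scaleR_right)
  have "blinfun_apply p e \<le> 1" "blinfun_apply p \<nu> \<le> 1"
    using blinfun_apply_le_norm[of p] p e \<nu> by (metis order_refl)+
  then have "h * blinfun_apply p e \<le> h" "d x * blinfun_apply p \<nu> \<le> d x"
    using kh k x by (simp_all add: mult_left_le)
  then have pe: "k \<le> h * blinfun_apply p e" and p\<nu>: "r - h \<le> d x * blinfun_apply p \<nu>"
    using p_sum by (auto simp: k_def)
  have "norm (e - \<nu>) < \<eta> / (2 * k)"
  proof (rule \<delta>(2))
    have "(1 - \<epsilon>) * h \<le> blinfun_apply p e * h" using pe hk by (simp add: mult.commute)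
    then have "1 - \<epsilon> \<le> blinfun_apply p e" using kh k by simp
    then show "1 - \<delta> < blinfun_apply p e" using \<epsilon> \<delta>(1) by linarith
    have "d x - \<delta> * d x / 2 \<le> d x * blinfun_apply p \<nu>"
      using p\<nu> \<open>h - k \<le> 2 * k * \<epsilon>\<close> \<epsilon>k unfolding k_def by linarith
    then have "d x * (1 - \<delta> / 2) \<le> d x * blinfun_apply p \<nu>" by (simp add: algebra_simps)
    then have "1 - \<delta> / 2 \<le> blinfun_apply p \<nu>" using x by simp
    then show "1 - \<delta> < blinfun_apply p \<nu>" using \<delta>(1) by linarith
  qed (use p e \<nu> in auto)
  then have "k * norm (e - \<nu>) < \<eta> / 2" using k by (simp add: field_simps)
  moreover have "y - (proj x + r *\<^sub>R \<nu>) = (h - k) *\<^sub>R e + k *\<^sub>R (e - \<nu>)"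
    using e \<nu> by (simp add: k_def algebra_simps)
  then have "norm (y - (proj x + r *\<^sub>R \<nu>)) \<le> (h - k) + k * norm (e - \<nu>)"
    using norm_triangle_ineq[of "(h - k) *\<^sub>R e" "k *\<^sub>R (e - \<nu>)"] kh k e by simp
  ultimately have "norm (y - (proj x + r *\<^sub>R \<nu>)) < \<eta>"
    using \<open>h - k \<le> 2 * k * \<epsilon>\<close> \<epsilon>k by linarith
  then show ?thesis using y by (auto simp: \<nu>_def)
qed

lemma infdist_along_ray:
  assumes "0 < d x" "d x < r" "r < R"
  shows "r \<le> d (proj x + r *\<^sub>R ((x - proj x) /\<^sub>R d x))"
proof (rule field_le_epsilon)
  fix \<eta> :: real assume "0 < \<eta>"
  then obtain y where "d y = r" "norm (y - (proj x + r *\<^sub>R ((x - proj x) /\<^sub>R d x))) < \<eta>"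
    using near_ray_at_distance[OF assms] by blast
  then show "r \<le> d (proj x + r *\<^sub>R ((x - proj x) /\<^sub>R d x)) + \<eta>"
    using infdist_triangle[of y A "proj x + r *\<^sub>R ((x - proj x) /\<^sub>R d x)"] by (simp add: dist_norm)
qed

text \<open>This is the passage to the limit r -> R in \<open>infdist_along_ray\<close>: a point of
  A inside the limiting ball would already lie inside the balls of radius r close to R.\<close>

lemma supporting_ball:
  assumes x: "0 < d x" "d x < R" and b: "b \<in> A"
  shows "R \<le> norm (proj x + R *\<^sub>R ((x - proj x) /\<^sub>R d x) - b)"
proof (rule ccontr)
  define \<nu> where "\<nu> = (x - proj x) /\<^sub>R d x"
  have \<nu>: "norm \<nu> = 1" using x norm_proj[OF x(2)] by (simp add: \<nu>_def)
  define q where "q = norm (proj x + R *\<^sub>R \<nu> - b)"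
  assume "\<not> ?thesis"
  then have "q < R" by (simp add: q_def \<nu>_def)
  then have "max ((R + q) / 2) (d x) < R" using x by simp
  \<comment> \<open>The first condition means q + (R - r) < r, so b would be too close to the centre
    belonging to r.\<close>
  then obtain r where r: "(R + q) / 2 < r" "d x < r" "r < R" using dense by (metis max_less_iff_conj)
  have "r \<le> norm (proj x + r *\<^sub>R \<nu> - b)"
    using infdist_along_ray[OF x(1) r(2,3)] d_le[OF b] unfolding \<nu>_def by (meson order_trans)
  also have "proj x + r *\<^sub>R \<nu> - b = (proj x + R *\<^sub>R \<nu> - b) - (R - r) *\<^sub>R \<nu>"
    by (simp add: algebra_simps)
  also have "norm \<dots> \<le> q + (R - r)"
    using norm_triangle_ineq4[of "proj x + R *\<^sub>R \<nu> - b" "(R - r) *\<^sub>R \<nu>"] \<nu> r by (simp add: q_def)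
  finally show False using r by (simp add: field_simps)
qed

end

section \<open>Existence of slice-projections and the estimate for one refinement\<close>

subsection \<open>Slice-projections\<close>

lemma closed_segment_dist_min:
  fixes u v z :: "'a::real_normed_vector"
  assumes "z \<in> closed_segment u v"
  shows "min (norm (z - u)) (norm (z - v)) \<le> norm (u - v) / 2"
    and "norm (z - u) \<le> norm (u - v)" and "norm (z - v) \<le> norm (u - v)"
proof -
  obtain t where t: "0 \<le> t" "t \<le> 1" "z = (1 - t) *\<^sub>R u + t *\<^sub>R v"
    using assms by (auto simp: closed_segment_def)
  have "z - u = t *\<^sub>R (v - u)" "z - v = (1 - t) *\<^sub>R (u - v)"
    by (simp_all add: t(3) algebra_simps)
  then have n: "norm (z - u) = t * norm (u - v)" "norm (z - v) = (1 - t) * norm (u - v)"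
    using t by (simp_all add: norm_minus_commute)
  show "norm (z - u) \<le> norm (u - v)" "norm (z - v) \<le> norm (u - v)"
    unfolding n using t by (auto intro: mult_left_le_one_le)
  have "norm (z - u) + norm (z - v) = norm (u - v)" unfolding n by (simp add: algebra_simps)
  then show "min (norm (z - u)) (norm (z - v)) \<le> norm (u - v) / 2" by linarith
qed

lemma minus_midpoint:
  fixes u v :: "'a::real_normed_vector"
  shows "u - midpoint u v = (1 / 2) *\<^sub>R (u - v)" and "v - midpoint u v = (- 1 / 2) *\<^sub>R (u - v)"
  unfolding midpoint_def by (auto simp: algebra_simps simp flip: scaleR_add_left)

text \<open>The opposite signs at the two ends serve the intermediate value argument, and the
  non-zero values separate slice-projections from u and v.\<close>

lemma (in power_smooth) norming_functional_ends:
  assumes "u \<noteq> (v :: 'a)"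
  shows "blinfun_apply (norming_functional (u - v)) (u - midpoint u v) = norm (u - v) / 2"
    and "blinfun_apply (norming_functional (u - v)) (v - midpoint u v) = - (norm (u - v) / 2)"
proof -
  have "u - v \<noteq> 0" using assms by simp
  note self = norming_functional_self[OF this]
  show "blinfun_apply (norming_functional (u - v)) (u - midpoint u v) = norm (u - v) / 2"
    unfolding minus_midpoint blinfun.scaleR_right self by simp
  show "blinfun_apply (norming_functional (u - v)) (v - midpoint u v) = - (norm (u - v) / 2)"
    unfolding minus_midpoint blinfun.scaleR_right self by simp
qed

context proximal_set
begin

text \<open>The nearer endpoint is at most half the chord away. A chord shorter than 2R thus stays
  where the projection is single-valued and continuous.\<close>

lemma infdist_segment_le:
  assumes "u \<in> A" "v \<in> A" "z \<in> closed_segment u v"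
  shows "d z \<le> norm (u - v) / 2"
  using closed_segment_dist_min(1)[OF assms(3)] d_le[OF assms(1), of z] d_le[OF assms(2), of z]
  by linarith

lemma in_slice_projections_iff:
  "w \<in> slice_projections R A u v \<longleftrightarrow> u \<in> A \<and> v \<in> A \<and> u \<noteq> v \<and> norm (u - v) < 2 * R \<and>
     (\<exists>z\<in>closed_segment u v. w = proj z) \<and>
     blinfun_apply (norming_functional (u - v)) (w - midpoint u v) = 0" (is "?l \<longleftrightarrow> ?r")
proof -
  have "w \<in> (\<lambda>h. h + midpoint u v) ` norming_hyperplane (u - v) \<longleftrightarrow>
      blinfun_apply (norming_functional (u - v)) (w - midpoint u v) = 0"
    by (force simp: norming_hyperplane_def image_iff intro: exI[of _ "w - midpoint u v"])
  moreover have "w \<in> (\<Union>x\<in>closed_segment u v. metric_projection A x) \<longleftrightarrow>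
      (\<exists>z\<in>closed_segment u v. w = proj z)" if "u \<in> A" "v \<in> A" "norm (u - v) < 2 * R"
  proof -
    have "metric_projection A z = {proj z}" if "z \<in> closed_segment u v" for z
      using infdist_segment_le[OF \<open>u \<in> A\<close> \<open>v \<in> A\<close> that] \<open>norm (u - v) < 2 * R\<close>
      by (intro metric_projection_eq) simp
    then show ?thesis by auto
  qed
  ultimately show ?thesis unfolding slice_projections_def by blast
qed

text \<open>The projection runs continuously from u to v along the chord, so the norming functional
  of u - v, measured from the midpoint, changes sign.\<close>

lemma slice_projections_nonempty:
  assumes uv: "u \<in> A" "v \<in> A" "u \<noteq> v" "norm (u - v) < 2 * R"
  shows "slice_projections R A u v \<noteq> {}"
proof -
  have R0: "0 < R" using uv(4) norm_ge_zero[of "u - v"] by linarith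
  define z where "z t = (1 - t) *\<^sub>R u + t *\<^sub>R v" for t :: real
  have z: "z t \<in> closed_segment u v" if "0 \<le> t" "t \<le> 1" for t
    using that by (auto simp: closed_segment_def z_def)
  then have dz: "d (z t) < R" if "0 \<le> t" "t \<le> 1" for t
    using infdist_segment_le[OF uv(1,2) z[OF that]] uv(4) by simp
  define \<phi> where "\<phi> t = blinfun_apply (norming_functional (u - v)) (proj (z t) - midpoint u v)" for t
  have "continuous_on {0..1} z" unfolding z_def by (intro continuous_intros)
  then have "continuous_on {0..1} (\<lambda>t. proj (z t))"
    by (rule continuous_on_compose2[OF continuous_on_proj]) (use dz in auto)
  then have "continuous_on {0..1} \<phi>" unfolding \<phi>_def by (intro continuous_intros)
  moreover have "\<phi> 1 \<le> 0" "0 \<le> \<phi> 0"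
    using uv R0 by (simp_all add: \<phi>_def z_def proj_self norming_functional_ends)
  ultimately obtain t where "0 \<le> t" "t \<le> 1" "\<phi> t = 0"
    using IVT2'[of \<phi> 1 0 0] by auto
  then have "proj (z t) \<in> slice_projections R A u v"
    unfolding in_slice_projections_iff using uv z \<phi>_def by auto
  then show ?thesis by blast
qed

text \<open>The ball touching A at proj z has centre proj z + R \<nu>. Expanding the norm at R \<nu>
  shows that u and v rise above the tangent hyperplane at proj z only by a term of order s, and d z
  is a convex combination of these two heights.\<close>

lemma infdist_segment_bound:
  assumes uv: "u \<in> A" "v \<in> A" "norm (u - v) < 2 * R" and z: "z \<in> closed_segment u v"
  shows "d z \<le> 2 * C * R * (2 * norm (u - v) / R) powr s"
proof (cases "d z = 0")
  case True
  have "0 < R" using uv(3) norm_ge_zero[of "u - v"] by linarith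
  then show ?thesis using True C_pos by simp
next
  case False
  define l where "l = norm (u - v)"
  have R0: "0 < R" using uv(3) norm_ge_zero[of "u - v"] by linarith
  have dz: "0 < d z" "d z \<le> l / 2" "d z < R"
    using False infdist_nonneg[of z A] infdist_segment_le[OF uv(1,2) z] uv(3) by (auto simp: l_def)
  define \<nu> where "\<nu> = (z - proj z) /\<^sub>R d z"
  have \<nu>: "norm \<nu> = 1" "z - proj z = d z *\<^sub>R \<nu>" using dz norm_proj[of z] by (auto simp: \<nu>_def)
  have ne: "R *\<^sub>R \<nu> \<noteq> 0" using R0 \<nu> by auto
  define p where "p = norming_functional (R *\<^sub>R \<nu>)"
  have "R * blinfun_apply p \<nu> = R"
    using norming_functional_self[OF ne] R0 \<nu> by (simp add: p_def blinfun.scaleR_right)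
  then have p\<nu>: "blinfun_apply p \<nu> = 1" using R0 by simp
  have bound: "blinfun_apply p (b - proj z) \<le> 2 * C * R * (2 * l / R) powr s"
    if b: "b \<in> A" "norm (z - b) \<le> l" for b
  proof -
    have "R \<le> norm (R *\<^sub>R \<nu> + (proj z - b))"
      using supporting_ball[OF dz(1,3) b(1)] by (simp add: \<nu>_def algebra_simps)
    also have "\<dots> \<le> norm (R *\<^sub>R \<nu>) + blinfun_apply p (proj z - b)
        + 2 * C * norm (R *\<^sub>R \<nu>) * (norm (proj z - b) / norm (R *\<^sub>R \<nu>)) powr s"
      unfolding p_def by (rule norm_add_le_smooth[OF ne])
    finally have "blinfun_apply p (b - proj z) \<le> 2 * C * R * (norm (proj z - b) / R) powr s"
      using R0 \<nu> by (simp add: blinfun.diff_right)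
    also have "\<dots> \<le> 2 * C * R * (2 * l / R) powr s"
    proof (intro mult_left_mono powr_mono2 divide_right_mono)
      \<comment> \<open>The summands are at most l and l / 2; the factor 2 is a convenient upper
        bound.\<close>
      have "norm (proj z - b) \<le> norm (z - b) + norm (z - proj z)"
        using norm_triangle_ineq4[of "z - b" "z - proj z"] by simp
      then show "norm (proj z - b) \<le> 2 * l" using b dz norm_proj[of z] by simp
    qed (use R0 C_pos s_gt_1 in auto)
    finally show ?thesis .
  qed
  obtain t where t: "0 \<le> t" "t \<le> 1" "z = (1 - t) *\<^sub>R u + t *\<^sub>R v"
    using z by (auto simp: closed_segment_def)
  have "z - proj z = (1 - t) *\<^sub>R (u - proj z) + t *\<^sub>R (v - proj z)"
    by (simp add: t(3) algebra_simps)
  then have "d z = (1 - t) * blinfun_apply p (u - proj z) + t * blinfun_apply p (v - proj z)"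
    using \<nu>(2) p\<nu> by (metis blinfun.add_right blinfun.scaleR_right mult.right_neutral real_scaleR_def)
  also have "\<dots> \<le> 2 * C * R * (2 * l / R) powr s"
    using t bound[OF uv(1)] bound[OF uv(2)] closed_segment_dist_min(2,3)[OF z]
    by (intro convex_bound_le) (auto simp: l_def)
  finally show ?thesis by (simp add: l_def)
qed

text \<open>On the line through u and v the norming functional p of u - v measures distances
  exactly. As p vanishes at w - midpoint, the distance of z to the midpoint is |p (z - w)| <= d z,
  and a further d z leads from z to w.\<close>

lemma slice_projection_midpoint_bound:
  assumes w: "w \<in> slice_projections R A u v"
  shows "norm (w - midpoint u v) \<le> 4 * C * R * (2 * norm (u - v) / R) powr s"
proof -
  define l where "l = norm (u - v)"
  obtain z where uv: "u \<in> A" "v \<in> A" "u \<noteq> v" "norm (u - v) < 2 * R"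
    and z: "z \<in> closed_segment u v" "w = proj z"
    and w0: "blinfun_apply (norming_functional (u - v)) (w - midpoint u v) = 0"
    using w in_slice_projections_iff by blast
  define p where "p = norming_functional (u - v)"
  have p: "norm p = 1" "blinfun_apply p (u - v) = l"
    using norming_functional_props[of "u - v"] uv by (auto simp: p_def l_def)
  have wz: "norm (w - z) = d z"
    using norm_proj[of z] infdist_segment_le[OF uv(1,2) z(1)] uv(4) z(2) by (simp add: norm_minus_commute)
  obtain t where t: "z = (1 - t) *\<^sub>R u + t *\<^sub>R v" using z by (auto simp: closed_segment_def)
  have "z - u = (- t) *\<^sub>R (u - v)" unfolding t by (simp add: algebra_simps)
  then have "z - midpoint u v = (- t) *\<^sub>R (u - v) + (1 / 2) *\<^sub>R (u - v)"
    unfolding minus_midpoint(1)[symmetric] by (metis add_diff_eq diff_add_cancel)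
  then have zm: "z - midpoint u v = (1 / 2 - t) *\<^sub>R (u - v)"
    unfolding scaleR_add_left[symmetric] by simp
  have "norm (z - midpoint u v) = \<bar>blinfun_apply p (z - midpoint u v)\<bar>"
    unfolding zm blinfun.scaleR_right p(2) by (simp add: l_def abs_mult)
  also have "blinfun_apply p (z - midpoint u v) = blinfun_apply p (z - w)"
    using w0 by (simp add: p_def blinfun.diff_right)
  also have "\<bar>blinfun_apply p (z - w)\<bar> \<le> norm (z - w)"
    using norm_blinfun[of p "z - w"] p by simp
  finally have "norm (w - midpoint u v) \<le> 2 * d z"
    using norm_triangle_ineq[of "w - z" "z - midpoint u v"] wz by (simp add: norm_minus_commute)
  then show ?thesis using infdist_segment_bound[OF uv(1,2,4) z(1)] by simp
qed

text \<open>The vectors 2(u - w) and 2(w - v) differ from u - v by elements of the kernel of its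
  norming functional, so the first-order term of the norm vanishes. The relative deviation 2e / l is
  of order (l / R)^(s - 1), and the remainder raises it to the power s. In \<open>K\<close>, the
  factor 2C is that of the expansion and 8C 2^s bounds the relative deviation.\<close>

lemma slice_projection_step:
  assumes w: "w \<in> slice_projections R A u v"
  defines "K \<equiv> 2 * C * (8 * C * 2 powr s) powr s"
  shows "w \<in> A" "w \<noteq> u" "w \<noteq> v"
    "norm (u - w) \<le> norm (u - v) / 2 * (1 + K * (norm (u - v) / R) powr (s * (s - 1)))"
    "norm (w - v) \<le> norm (u - v) / 2 * (1 + K * (norm (u - v) / R) powr (s * (s - 1)))"
proof -
  define l where "l = norm (u - v)"
  define p where "p = norming_functional (u - v)"
  obtain z where uv: "u \<in> A" "v \<in> A" "u \<noteq> v" "norm (u - v) < 2 * R"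
    and z: "z \<in> closed_segment u v" "w = proj z"
    and w0: "blinfun_apply p (w - midpoint u v) = 0"
    using w in_slice_projections_iff p_def by blast
  have l: "0 < l" using uv by (simp add: l_def)
  then have R0: "0 < R" using uv(4) by (simp only: l_def)
  show "w \<in> A" using z infdist_segment_le[OF uv(1,2) z(1)] uv(4) by (simp add: proj_in)
  show "w \<noteq> u" "w \<noteq> v"
    using w0 norming_functional_ends[OF uv(3)] uv(3) by (auto simp: p_def)
  have "u - v \<noteq> 0" using uv by simp
  note smooth_uv = norm_add_le_smooth[OF this, folded p_def l_def]
  define e where "e = norm (w - midpoint u v)"
  have "2 * C * l * (2 * e / l) powr s \<le> l * (K * (l / R) powr (s * (s - 1)))"
  proof -
    have "2 * e / l \<le> 2 * (4 * C * R * (2 * l / R) powr s) / l"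
      using slice_projection_midpoint_bound[OF w] l
      by (intro divide_right_mono mult_left_mono) (auto simp: e_def l_def)
    also have "(2 * l / R) powr s = 2 powr s * (l / R) powr s"
      using powr_mult[of 2 "l / R" s] l R0 by simp
    also have "(l / R) powr s = (l / R) * (l / R) powr (s - 1)"
      using powr_add[of "l / R" 1 "s - 1"] l R0 by simp
    also have "2 * (4 * C * R * (2 powr s * ((l / R) * (l / R) powr (s - 1)))) / l
        = (8 * C * 2 powr s) * (l / R) powr (s - 1)"
      using l R0 by (simp add: field_simps)
    finally have "(2 * e / l) powr s \<le> ((8 * C * 2 powr s) * (l / R) powr (s - 1)) powr s"
      using s_gt_1 l by (intro powr_mono2) (auto simp: e_def)
    also have "\<dots> = (8 * C * 2 powr s) powr s * (l / R) powr (s * (s - 1))"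
      using C_pos by (simp add: powr_mult powr_powr mult.commute)
    finally have "2 * C * l * (2 * e / l) powr s
        \<le> 2 * C * l * ((8 * C * 2 powr s) powr s * (l / R) powr (s * (s - 1)))"
      using C_pos l by (intro mult_left_mono) auto
    then show ?thesis by (simp add: K_def mult_ac)
  qed
  then have half: "x \<le> l / 2 * (1 + K * (l / R) powr (s * (s - 1)))"
    if "2 * x \<le> l + 2 * C * l * (2 * e / l) powr s" for x
    using that by (simp add: algebra_simps)
  have m2: "2 *\<^sub>R midpoint u v = u + v" by (simp add: midpoint_def)
  have "2 *\<^sub>R (u - w) = (u - v) + (- 2) *\<^sub>R (w - midpoint u v)"
    unfolding scaleR_diff_right scaleR_minus_left m2 by (simp add: scaleR_2)
  then have "2 * norm (u - w) = norm ((u - v) + (- 2) *\<^sub>R (w - midpoint u v))"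
    by (metis abs_numeral norm_scaleR)
  also have "\<dots> \<le> l + 2 * C * l * (2 * e / l) powr s"
    using smooth_uv[of "(- 2) *\<^sub>R (w - midpoint u v)"] w0
    unfolding blinfun.scaleR_right by (simp add: e_def)
  finally show "norm (u - w) \<le> norm (u - v) / 2 * (1 + K * (norm (u - v) / R) powr (s * (s - 1)))"
    using half unfolding l_def by blast
  have "2 *\<^sub>R (w - v) = (u - v) + 2 *\<^sub>R (w - midpoint u v)"
    unfolding scaleR_diff_right scaleR_minus_left m2 by (simp add: scaleR_2)
  then have "2 * norm (w - v) = norm ((u - v) + 2 *\<^sub>R (w - midpoint u v))"
    by (metis abs_numeral norm_scaleR)
  also have "\<dots> \<le> l + 2 * C * l * (2 * e / l) powr s"
    using smooth_uv[of "2 *\<^sub>R (w - midpoint u v)"] w0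
    unfolding blinfun.scaleR_right by (simp add: e_def)
  finally show "norm (w - v) \<le> norm (u - v) / 2 * (1 + K * (norm (u - v) / R) powr (s * (s - 1)))"
    using half unfolding l_def by blast
qed

end

section \<open>Summing the errors over dyadic levels, and the Lipschitz extension\<close>

subsection \<open>The refinement\<close>

lemma dyadic_points_mono:
  assumes "i \<le> k"
  shows "dyadic_points i \<subseteq> dyadic_points k"
proof
  fix x assume "x \<in> dyadic_points i"
  then obtain j where j: "j \<le> 2 ^ i" "x = real j / 2 ^ i" by (auto simp: dyadic_points_def)
  have two: "(2 :: 'b::comm_semiring_1) ^ k = 2 ^ i * 2 ^ (k - i)"
    using assms by (metis le_add_diff_inverse power_add)
  have "x = real (j * 2 ^ (k - i)) / 2 ^ k" unfolding two j(2) by simp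
  moreover have "j * 2 ^ (k - i) \<le> 2 ^ k" unfolding two using j by simp
  ultimately show "x \<in> dyadic_points k" unfolding dyadic_points_def by blast
qed

lemma closure_dyadic_points: "closure (\<Union>i. dyadic_points i) = {0..1}"
proof -
  have "(\<Union>i. dyadic_points i) = {0..1} \<inter> (\<Union>k m. {real m / 2 ^ k})"
  proof (intro set_eqI iffI)
    fix x assume "x \<in> (\<Union>i. dyadic_points i)"
    then obtain i j where j: "j \<le> 2 ^ i" "x = real j / 2 ^ i" by (auto simp: dyadic_points_def)
    have "real j \<le> 2 ^ i" using j(1) by (metis of_nat_le_iff of_nat_numeral of_nat_power)
    then show "x \<in> {0..1} \<inter> (\<Union>k m. {real m / 2 ^ k})" using j by auto
  next
    fix x assume "x \<in> {0..1::real} \<inter> (\<Union>k m. {real m / 2 ^ k})"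
    then obtain k m where m: "x = real m / 2 ^ k" "x \<le> 1" by auto
    then have "real m \<le> real (2 ^ k)" by simp
    then have "m \<le> 2 ^ k" using of_nat_le_iff by blast
    then show "x \<in> (\<Union>i. dyadic_points i)" using m by (auto simp: dyadic_points_def)
  qed
  then show ?thesis
    using closure_dyadic_rationals_in_convex_set_pos_1[of "{0..1::real}"] by simp
qed

text \<open>Any two dyadic points lie on a common level, where the bounds for neighbouring points
  add up.\<close>

lemma lipschitz_on_dyadic_points:
  fixes f :: "real \<Rightarrow> 'a::real_normed_vector"
  assumes "0 \<le> B"
    and step: "\<And>k j. j < 2 ^ k \<Longrightarrow> norm (f (real (Suc j) / 2 ^ k) - f (real j / 2 ^ k)) \<le> B / 2 ^ k"
  shows "B-lipschitz_on (\<Union>i. dyadic_points i) f"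
proof (rule lipschitz_on_leI)
  have chain: "norm (f (real (i + m) / 2 ^ k) - f (real i / 2 ^ k)) \<le> B * (real m / 2 ^ k)"
    if "i + m \<le> 2 ^ k" for i m k
    using that
  proof (induction m)
    case (Suc m)
    have "norm (f (real (i + Suc m) / 2 ^ k) - f (real i / 2 ^ k))
      \<le> norm (f (real (Suc (i + m)) / 2 ^ k) - f (real (i + m) / 2 ^ k))
        + norm (f (real (i + m) / 2 ^ k) - f (real i / 2 ^ k))"
      using norm_triangle_ineq[of "f (real (Suc (i + m)) / 2 ^ k) - f (real (i + m) / 2 ^ k)"
        "f (real (i + m) / 2 ^ k) - f (real i / 2 ^ k)"] by simp
    also have "\<dots> \<le> B / 2 ^ k + B * (real m / 2 ^ k)"
      using Suc step[of "i + m" k] by (intro add_mono) auto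
    also have "\<dots> = B * (real (Suc m) / 2 ^ k)" by (simp add: field_simps)
    finally show ?case .
  qed simp
  fix x y :: real assume xy: "x \<in> (\<Union>i. dyadic_points i)" "y \<in> (\<Union>i. dyadic_points i)" "x \<le> y"
  then obtain i j where "x \<in> dyadic_points i" "y \<in> dyadic_points j" by blast
  then have "x \<in> dyadic_points (max i j)" "y \<in> dyadic_points (max i j)"
    using dyadic_points_mono[of i "max i j"] dyadic_points_mono[of j "max i j"] by auto
  then obtain k a b where k: "a \<le> 2 ^ k" "x = real a / 2 ^ k" "b \<le> 2 ^ k" "y = real b / 2 ^ k"
    unfolding dyadic_points_def by blast
  then have "real a \<le> real b" using xy(3) by (simp add: divide_le_cancel)
  then have "a \<le> b" by simp
  then have "norm (f y - f x) \<le> B * (real (b - a) / 2 ^ k)"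
    using chain[of a "b - a" k] k by simp
  also have "real (b - a) / 2 ^ k = y - x"
    using \<open>a \<le> b\<close> k by (simp add: of_nat_diff diff_divide_distrib)
  finally show "dist (f x) (f y) \<le> B * dist x y"
    using xy(3) by (simp add: dist_norm norm_minus_commute)
qed fact

lemma curve_length_le_lipschitz:
  assumes "B-lipschitz_on {a..b} g"
  shows "curve_length g a b \<le> ennreal (B * (b - a))"
  unfolding curve_length_def
proof (rule Sup_least, clarify)
  fix n and t :: "nat \<Rightarrow> real"
  assume t: "a = t 0" "b = t n" "mono_on {..n} t"
  have "(\<Sum>k<n. ennreal (norm (g (t (Suc k)) - g (t k))))
      = ennreal (\<Sum>k<n. norm (g (t (Suc k)) - g (t k)))"
    by (rule sum_ennreal) simp
  also have "\<dots> \<le> ennreal (\<Sum>k<n. B * (t (Suc k) - t k))"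
  proof (intro ennreal_leI sum_mono)
    fix k assume k: "k \<in> {..<n}"
    have le: "t i \<le> t j" if "i \<le> j" "j \<le> n" for i j
      using t(3) that by (auto simp: mono_on_def)
    have "dist (g (t (Suc k))) (g (t k)) \<le> B * dist (t (Suc k)) (t k)"
      using k le t(1,2) by (intro lipschitz_onD[OF assms]) auto
    then show "norm (g (t (Suc k)) - g (t k)) \<le> B * (t (Suc k) - t k)"
      using le[of k "Suc k"] k by (simp add: dist_norm)
  qed
  also have "(\<Sum>k<n. B * (t (Suc k) - t k)) = B * (t n - t 0)"
    by (simp add: sum_lessThan_telescope flip: sum_distrib_left)
  finally show "(\<Sum>k<n. ennreal (norm (g (t (Suc k)) - g (t k)))) \<le> ennreal (B * (t n - t 0))" .
qed

text \<open>The invariant replaces the product of the growth factors by the partial geometric sum 1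
  + L q (1 - \<theta>^k). It is at most 2 because L q <= 1, so the new error is at most 2 K 2^a q
  \<theta>^k. By the choice of L this is L q (\<theta>^k - \<theta>^(k + 1)), exactly the increment
  of the invariant.\<close>

lemma chord_growth_step:
  fixes a K L l l0 R :: real and k :: nat
  assumes a: "0 < a" and K: "0 < K" and R: "0 < R" and l0: "0 < l0"
  defines "\<theta> \<equiv> 2 powr (- a)" and "q \<equiv> (l0 / R) powr a"
  assumes L: "L * (1 - \<theta>) = 2 * K * 2 powr a" and Lq: "L * q \<le> 1"
    and l: "0 \<le> l" "l \<le> l0 / 2 ^ k * (1 + L * q * (1 - \<theta> ^ k))"
  shows "l / 2 * (1 + K * (l / R) powr a) \<le> l0 / 2 ^ Suc k * (1 + L * q * (1 - \<theta> ^ Suc k))"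
proof -
  define M where "M = 1 + L * q * (1 - \<theta> ^ k)"
  have \<theta>: "0 < \<theta>" "\<theta> < 1" using a by (auto simp: \<theta>_def powr_less_one)
  have "0 < L * (1 - \<theta>)" unfolding L using K by simp
  then have L0: "0 < L" using \<theta> by (simp add: zero_less_mult_iff)
  have q0: "0 \<le> q" by (simp add: q_def)
  have \<theta>k: "0 \<le> \<theta> ^ k" "\<theta> ^ k \<le> 1" using \<theta> by (auto simp: power_le_one)
  have "L * q * (1 - \<theta> ^ k) \<le> 1 * 1"
    using Lq \<theta>k L0 q0 by (intro mult_mono) auto
  moreover have "0 \<le> L * q * (1 - \<theta> ^ k)"
    using \<theta>k L0 q0 by (intro mult_nonneg_nonneg) auto
  ultimately have M: "1 \<le> M" "M \<le> 2" by (auto simp: M_def)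
  have "l / R \<le> 2 * (l0 / R) / 2 ^ k"
  proof -
    have "l0 / 2 ^ k * M \<le> l0 / 2 ^ k * 2" using M l0 by (intro mult_left_mono) auto
    then have "l \<le> 2 * l0 / 2 ^ k" using l(2) by (simp add: M_def)
    then show ?thesis using R by (simp add: field_simps)
  qed
  then have "(l / R) powr a \<le> (2 * (l0 / R) / 2 ^ k) powr a"
    using l a R by (intro powr_mono2) auto
  also have "\<dots> = 2 powr a * q * \<theta> ^ k"
  proof -
    have "(2 * (l0 / R) / 2 ^ k) powr a = 2 powr a * q / (2 ^ k) powr a"
      using l0 R by (simp add: powr_mult powr_divide q_def)
    also have "((2::real) ^ k) powr a = (2 powr a) ^ k"
      by (simp add: powr_realpow[symmetric] powr_powr mult.commute)
    finally show ?thesis by (simp add: \<theta>_def powr_minus divide_inverse power_inverse)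
  qed
  finally have pw: "(l / R) powr a \<le> 2 powr a * q * \<theta> ^ k" .
  have "0 \<le> l0 / 2 ^ k * M" using M l0 by simp
  then have "l / 2 * (1 + K * (l / R) powr a) \<le> (l0 / 2 ^ k * M) / 2 * (1 + K * (2 powr a * q * \<theta> ^ k))"
    using pw l K q0 \<theta>k by (intro mult_mono divide_right_mono add_mono mult_left_mono) (use M l0 in \<open>auto simp flip: M_def\<close>)
  also have "\<dots> = l0 / 2 ^ Suc k * (M + M * (K * (2 powr a * q * \<theta> ^ k)))"
    by (simp add: field_simps)
  also have "\<dots> \<le> l0 / 2 ^ Suc k * (M + 2 * (K * (2 powr a * q * \<theta> ^ k)))"
    using M l0 K q0 \<theta>k by (intro mult_left_mono add_left_mono mult_right_mono) auto
  also have "2 * (K * (2 powr a * q * \<theta> ^ k)) = L * (1 - \<theta>) * q * \<theta> ^ k"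
    unfolding L by simp
  also have "M + L * (1 - \<theta>) * q * \<theta> ^ k = 1 + L * q * (1 - \<theta> ^ Suc k)"
    by (simp add: M_def algebra_simps)
  finally show ?thesis .
qed

lemma construction_steps_midpoint:
  assumes "construction_steps R A x0 x1 n f" "k < n" "1 \<le> j" "j \<le> 2 ^ k"
  shows "f ((2 * real j - 1) / 2 ^ Suc k) \<in> slice_projections R A (f ((real j - 1) / 2 ^ k)) (f (real j / 2 ^ k))"
proof -
  have "Suc k \<in> {1..n}" "j \<in> {1..2 ^ (Suc k - 1)}" using assms by auto
  then show ?thesis using assms(1) unfolding construction_steps_def by force
qed

context proximal_set
begin

text \<open>The induction carries membership in A and distinctness of neighbours along with the
  length bound, so that each level again consists of proper chords of A.\<close>

lemma construction_steps_chords: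
  fixes L :: real and x0 x1 :: 'a
  defines "K \<equiv> 2 * C * (8 * C * 2 powr s) powr s" and "a \<equiv> s * (s - 1)"
  defines "\<theta> \<equiv> 2 powr (- a)" and "q \<equiv> (norm (x0 - x1) / R) powr a"
  assumes L: "L * (1 - \<theta>) = 2 * K * 2 powr a" and Lq: "L * q \<le> 1"
    and x: "x0 \<in> A" "x1 \<in> A" "x0 \<noteq> x1" and R: "0 < R"
    and f: "construction_steps R A x0 x1 n f"
    and k: "k \<le> n" and j: "1 \<le> j" "j \<le> 2 ^ k"
  shows "f ((real j - 1) / 2 ^ k) \<in> A \<and> f (real j / 2 ^ k) \<in> A \<and>
    f ((real j - 1) / 2 ^ k) \<noteq> f (real j / 2 ^ k) \<and>
    norm (f ((real j - 1) / 2 ^ k) - f (real j / 2 ^ k))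
      \<le> norm (x0 - x1) / 2 ^ k * (1 + L * q * (1 - \<theta> ^ k))"
  using k j
proof (induction k arbitrary: j)
  case 0
  then have "j = 1" by simp
  then show ?case using f x by (simp add: construction_steps_def)
next
  case (Suc k)
  have a0: "0 < a" using s_gt_1 by (simp add: a_def)
  have K0: "0 < K" using C_pos by (simp add: K_def)
  \<comment> \<open>With intervals counted from 1, i is the parent of the j-th interval; even j is
    its right half, odd j its left half.\<close>
  define i where "i = (j + 1) div 2"
  have i: "1 \<le> i" "i \<le> 2 ^ k" using Suc.prems by (auto simp: i_def)
  define u v w where "u = f ((real i - 1) / 2 ^ k)" and "v = f (real i / 2 ^ k)"
    and "w = f ((2 * real i - 1) / 2 ^ Suc k)"
  have uv: "u \<in> A" "v \<in> A" "u \<noteq> v"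
    "norm (u - v) \<le> norm (x0 - x1) / 2 ^ k * (1 + L * q * (1 - \<theta> ^ k))"
    using Suc.IH[of i] i Suc.prems by (auto simp: u_def v_def)
  have w: "w \<in> slice_projections R A u v"
    using construction_steps_midpoint[OF f, of k i] i Suc.prems by (simp add: u_def v_def w_def)
  note step = slice_projection_step[OF w, folded K_def a_def]
  have growth: "norm (u - v) / 2 * (1 + K * (norm (u - v) / R) powr a)
      \<le> norm (x0 - x1) / 2 ^ Suc k * (1 + L * q * (1 - \<theta> ^ Suc k))"
    unfolding \<theta>_def q_def
    by (rule chord_growth_step)
      (use a0 K0 R x L Lq uv in \<open>simp_all add: \<theta>_def q_def\<close>)
  have le: "norm (u - w) \<le> norm (x0 - x1) / 2 ^ Suc k * (1 + L * q * (1 - \<theta> ^ Suc k))"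
    "norm (w - v) \<le> norm (x0 - x1) / 2 ^ Suc k * (1 + L * q * (1 - \<theta> ^ Suc k))"
    using step(4,5) growth by linarith+
  show ?case
  proof (cases "even j")
    case True
    then have "j = 2 * i" by (simp add: i_def)
    then have eqs: "f ((real j - 1) / 2 ^ Suc k) = w" "f (real j / 2 ^ Suc k) = v"
      by (simp_all add: w_def v_def)
    show ?thesis unfolding eqs using step(1-3) uv(2) le(2) by blast
  next
    case False
    then have "j = 2 * i - 1" by (auto simp: i_def elim: oddE)
    then have "real j = 2 * real i - 1" using i by (simp add: of_nat_diff)
    then have j: "real j - 1 = 2 * (real i - 1)" "f (real j / 2 ^ Suc k) = w" by (simp_all add: w_def)
    have "(real j - 1) / 2 ^ Suc k = (real i - 1) / 2 ^ k"
      unfolding j(1) power_Suc by (rule mult_divide_mult_cancel_left) simp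
    then have "f ((real j - 1) / 2 ^ Suc k) = u" by (simp only: u_def)
    then show ?thesis unfolding j(2) using step(1-3) uv(1) le(1) by metis
  qed
qed

end

lemma proximally_smooth_imp_proximal_set:
  fixes A :: "'a::banach set"
  assumes "power_smooth TYPE('a) C s" "uniformly_convex_space TYPE('a)" "proximally_smooth R A" "A \<noteq> {}"
  obtains D where "proximal_set C s R A D"
proof -
  obtain D where D: "\<forall>x \<in> {x. 0 < infdist x A \<and> infdist x A < R}.
      ((\<lambda>z. infdist z A) has_derivative blinfun_apply (D x)) (at x)"
    using assms(3) unfolding proximally_smooth_def by blast
  have "proximal_set C s R A D"
    using assms D unfolding proximal_set_def proximal_set_axioms_def proximally_smooth_def by auto
  then show thesis by (rule that)
qed

theorem theorem1:
  fixes s :: real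
  assumes "uniformly_convex_space TYPE('a::banach)"
    and "uniformly_smooth_space TYPE('a)"
    and "1 < s" and "s \<le> 2"
    and "smoothness_power_type TYPE('a) s"
  shows "\<exists>\<beta>\<^sub>L>0. \<exists>L>0. \<forall>R>0. \<forall>(A :: 'a set) x\<^sub>0 x\<^sub>1.
    proximally_smooth R A \<and> x\<^sub>0 \<in> A \<and> x\<^sub>1 \<in> A \<and> x\<^sub>0 \<noteq> x\<^sub>1 \<and> norm (x\<^sub>0 - x\<^sub>1) / R < \<beta>\<^sub>L \<longrightarrow>
      (\<forall>n f. construction_steps R A x\<^sub>0 x\<^sub>1 n f \<longrightarrow>
         (\<forall>j \<in> {1..2 ^ n}.
            slice_projections R A (f ((real j - 1) / 2 ^ n)) (f (real j / 2 ^ n)) \<noteq> {})) \<and>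
      (\<forall>f. (\<forall>n. construction_steps R A x\<^sub>0 x\<^sub>1 n f) \<longrightarrow>
         (\<exists>g. continuous_on {0..1} g \<and> g ` {0..1} \<subseteq> A \<and> g 0 = x\<^sub>0 \<and> g 1 = x\<^sub>1 \<and>
              (\<forall>i. \<forall>t \<in> dyadic_points i. g t = f t) \<and>
              curve_length g 0 1 \<le>
                ennreal (norm (x\<^sub>0 - x\<^sub>1) *
                  (1 + L * (norm (x\<^sub>0 - x\<^sub>1) / R) powr (s * (s - 1))))))"
proof -
  obtain C where smooth: "power_smooth TYPE('a) C s"
    using smoothness_power_type_imp_power_smooth assms by blast
  have C0: "0 < C" using smooth by (simp add: power_smooth_def)
  define K where "K = 2 * C * (8 * C * 2 powr s) powr s"
  define a where "a = s * (s - 1)"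
  have a0: "0 < a" using assms by (simp add: a_def)
  have K0: "0 < K" using C0 by (simp add: K_def)
  define \<theta> :: real where "\<theta> = 2 powr (- a)"
  have \<theta>: "0 < \<theta>" "\<theta> < 1" using a0 by (auto simp: \<theta>_def powr_less_one)
  \<comment> \<open>The sum of the geometric series of errors bounded in
    \<open>chord_growth_step\<close>.\<close>
  define L where "L = 2 * K * 2 powr a / (1 - \<theta>)"
  have L0: "0 < L" using K0 \<theta> by (simp add: L_def)
  have L: "L * (1 - \<theta>) = 2 * K * 2 powr a" using \<theta> by (simp add: L_def)
  \<comment> \<open>The second bound gives L q <= 1. The first gives norm (x0 - x1) < R, so that all
    chords, at most twice as long, stay below 2R.\<close>
  define \<beta> where "\<beta> = min 1 (L powr (- 1 / a))"
  show ?thesis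
  proof (rule exI[of _ \<beta>], intro conjI exI[of _ L] allI impI ballI)
    show "0 < \<beta>" using L0 by (simp add: \<beta>_def)
    show "0 < L" by fact
    fix R :: real and A :: "'a set" and x0 x1
    assume R: "0 < R" and "proximally_smooth R A \<and> x0 \<in> A \<and> x1 \<in> A \<and> x0 \<noteq> x1 \<and> norm (x0 - x1) / R < \<beta>"
    then have A: "proximally_smooth R A" and x: "x0 \<in> A" "x1 \<in> A" "x0 \<noteq> x1"
      and \<beta>: "norm (x0 - x1) / R < \<beta>" by auto
    obtain D where "proximal_set C s R A D"
      using proximally_smooth_imp_proximal_set[OF smooth assms(1) A] x by blast
    then interpret proximal_set "TYPE('a)" C s R A D .
    define q where "q = (norm (x0 - x1) / R) powr a"
    have q0: "0 \<le> q" by (simp add: q_def)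
    have "q \<le> (L powr (- 1 / a)) powr a"
      unfolding q_def using \<beta> R a0 by (intro powr_mono2) (auto simp: \<beta>_def)
    also have "\<dots> = L powr (- 1)" using a0 unfolding powr_powr by simp
    also have "\<dots> = 1 / L" using L0 by (simp add: powr_minus divide_inverse)
    finally have Lq: "L * q \<le> 1" using L0 by (simp add: field_simps)
    define B where "B = norm (x0 - x1) * (1 + L * q)"
    have B0: "0 \<le> B" using L0 q0 by (simp add: B_def)
    have chords: "f ((real j - 1) / 2 ^ k) \<in> A \<and> f (real j / 2 ^ k) \<in> A \<and>
        f ((real j - 1) / 2 ^ k) \<noteq> f (real j / 2 ^ k) \<and>
        norm (f ((real j - 1) / 2 ^ k) - f (real j / 2 ^ k)) \<le> B / 2 ^ k"
      if "construction_steps R A x0 x1 k f" "1 \<le> j" "j \<le> 2 ^ k" for k j f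
    proof -
      have "norm (x0 - x1) / 2 ^ k * (1 + L * q * (1 - \<theta> ^ k)) \<le> norm (x0 - x1) / 2 ^ k * (1 + L * q)"
        using L0 q0 \<theta> by (intro mult_left_mono add_left_mono mult_left_le) auto
      also have "\<dots> = B / 2 ^ k" by (simp add: B_def)
      finally have B: "norm (x0 - x1) / 2 ^ k * (1 + L * q * (1 - \<theta> ^ k)) \<le> B / 2 ^ k" .
      have "f ((real j - 1) / 2 ^ k) \<in> A \<and> f (real j / 2 ^ k) \<in> A \<and>
        f ((real j - 1) / 2 ^ k) \<noteq> f (real j / 2 ^ k) \<and>
        norm (f ((real j - 1) / 2 ^ k) - f (real j / 2 ^ k))
          \<le> norm (x0 - x1) / 2 ^ k * (1 + L * q * (1 - \<theta> ^ k))"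
        using construction_steps_chords[of L x0 x1 k f k j] L Lq x R that
        unfolding K_def a_def \<theta>_def q_def by blast
      then show ?thesis using B by linarith
    qed
    have "B < 2 * R"
    proof -
      have "norm (x0 - x1) < R" using \<beta> R by (simp add: \<beta>_def field_simps)
      moreover have "B \<le> norm (x0 - x1) * 2" unfolding B_def using Lq by (intro mult_left_mono) auto
      ultimately show ?thesis by linarith
    qed
    show "slice_projections R A (f ((real j - 1) / 2 ^ n)) (f (real j / 2 ^ n)) \<noteq> {}"
      if "construction_steps R A x0 x1 n f" "j \<in> {1..2 ^ n}" for n f j
    proof -
      have "B / 2 ^ n \<le> B" using B0 by (simp add: divide_le_eq mult_le_cancel_left1)
      then show ?thesis
        using chords[OF that(1), of j] that(2) \<open>B < 2 * R\<close> by (intro slice_projections_nonempty) auto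
    qed
    fix f assume f: "\<forall>n. construction_steps R A x0 x1 n f"
    have f01: "f 0 = x0" "f 1 = x1" using f by (auto simp: construction_steps_def)
    have "B-lipschitz_on (\<Union>i. dyadic_points i) f"
    proof (rule lipschitz_on_dyadic_points[OF B0])
      fix j k :: nat assume "j < 2 ^ k"
      then show "norm (f (real (Suc j) / 2 ^ k) - f (real j / 2 ^ k)) \<le> B / 2 ^ k"
        using chords[of k f "Suc j"] f by (simp add: norm_minus_commute)
    qed
    \<comment> \<open>Completeness of the space extends f to the closure of the dyadic points with
      the same constant B, which then bounds the length.\<close>
    then obtain g where g: "B-lipschitz_on {0..1} g" "\<And>t. t \<in> (\<Union>i. dyadic_points i) \<Longrightarrow> g t = f t"
      using lipschitz_extend_closure closure_dyadic_points by metis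
    have f_A: "f t \<in> A" if t: "t \<in> dyadic_points i" for t i
    proof -
      obtain j where j: "j \<le> 2 ^ i" "t = real j / 2 ^ i" using t by (auto simp: dyadic_points_def)
      then show ?thesis
        using chords[of i f j] f f01 x by (cases "j = 0") auto
    qed
    have cont: "continuous_on {0..1} g" using g(1) by (rule lipschitz_on_continuous_on)
    have "g ` closure (\<Union>i. dyadic_points i) \<subseteq> A"
      using cont closed_A f_A g(2) by (intro image_closure_subset) (auto simp: closure_dyadic_points)
    then have "g ` {0..1} \<subseteq> A" by (simp add: closure_dyadic_points)
    moreover have "0 \<in> dyadic_points 0" "1 \<in> dyadic_points 0"
      by (auto simp: dyadic_points_def intro: exI[of _ 0] exI[of _ 1])
    then have "g 0 = x0" "g 1 = x1" using g(2) f01 by auto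
    moreover have "curve_length g 0 1 \<le> ennreal B"
      using curve_length_le_lipschitz[OF g(1)] by simp
    ultimately show "\<exists>g. continuous_on {0..1} g \<and> g ` {0..1} \<subseteq> A \<and> g 0 = x0 \<and> g 1 = x1 \<and>
        (\<forall>i. \<forall>t \<in> dyadic_points i. g t = f t) \<and>
        curve_length g 0 1 \<le> ennreal (norm (x0 - x1) * (1 + L * (norm (x0 - x1) / R) powr (s * (s - 1))))"
      using cont g(2) by (intro exI[of _ g]) (auto simp: B_def q_def a_def)
  qed
qed

end
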